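(* There is an algorithm which, given data $(X_1,Y_1),\dots,(X_n,Y_n)\in\mathbb{R}^2$, a family $\mathcal{B}$ of compact intervals with endpoints in $\{X_1,\dots,X_n\}$, and critical values $c_\ell(m)=F_{m,\gamma}^{-1}(\kappa)$, $c_u(m)=F_{m,1-\gamma}^{-1}(\kappa)$ for $1\le m\le n$ (with $\gamma\in(0,1)$ and $\kappa\in(0,1]$), computes the vectors $(L(z_j))_{j=1}^{\tilde n}$ and $(U(z_j))_{j=1}^{\tilde n}$ in $O(n^2)$ steps, where $z_1<\cdots<z_{\tilde n}$ are the distinct elements of $\{X_1,\dots,X_n\}$ and $$L(x):=\sup_{B\in\mathcal{B}:\,\max(B)\le x} Y_{B:c_\ell(N(B))},\qquad U(x):=\inf_{B\in\mathcal{B}:\,\min(B)\ge x} Y_{B:N(B)+1-c_u(N(B))}.$$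
   Context: For an interval $B$, $N(B):=\#\{i:X_i\in B\}$. $F_{m,p}$ is the distribution function of the binomial distribution with parameters $m$ and $p$, and $F_{m,p}^{-1}(\kappa):=\min\{k\in\{0,1,\dots,m\}: F_{m,p}(k)\ge\kappa\}$. $Y_{B:1}\le\cdots\le Y_{B:N(B)}$ are the order statistics of the $Y_i$ with $X_i\in B$, $Y_{B:0}:=-\infty$, $Y_{B:N(B)+1}:=\infty$; $\sup(\emptyset):=-\infty$, $\inf(\emptyset):=\infty$. Steps are counted in the unit-cost model: comparisons of real numbers, integer arithmetic, look-up of the critical values $c_\ell(m),c_u(m)$ and the test whether an interval $[z_j,z_k]$ belongs to $\mathcal{B}$ each cost one step. The constant in $O(n^2)$ is universal. *)

theory Defs
  imports "HOL-Probability.Probability"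
begin

section \<open>Binomial quantiles, order statistics and the two bounds\<close>

definition binom_cdf :: "nat \<Rightarrow> real \<Rightarrow> nat \<Rightarrow> real" where
  "binom_cdf m p k = measure_pmf.prob (binomial_pmf m p) {..k}"

definition binom_quantile :: "nat \<Rightarrow> real \<Rightarrow> real \<Rightarrow> nat" where
  "binom_quantile m p \<kappa> = Min {k \<in> {0..m}. binom_cdf m p k \<ge> \<kappa>}"

text \<open>The data are \<open>(X i, Y i)\<close> for \<open>1 \<le> i \<le> n\<close>; values at other indices are irrelevant.\<close>

definition num_in :: "nat \<Rightarrow> (nat \<Rightarrow> real) \<Rightarrow> real set \<Rightarrow> nat" where
  "num_in n X B = card {i \<in> {1..n}. X i \<in> B}"

definition ord_stat :: "nat \<Rightarrow> (nat \<Rightarrow> real) \<Rightarrow> (nat \<Rightarrow> real) \<Rightarrow> real set \<Rightarrow> nat \<Rightarrow> ereal" where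
  "ord_stat n X Y B k =
     (if k = 0 then -\<infinity>
      else if k \<le> num_in n X B
           then ereal (sort (map Y (filter (\<lambda>i. X i \<in> B) [1..<Suc n])) ! (k - 1))
      else \<infinity>)"

text \<open>Sets in the family are nonempty compact intervals, so that \<open>Sup B\<close> and \<open>Inf B\<close> are
  the maximum and the minimum of \<open>B\<close> (the constant \<open>Max\<close> only makes sense on finite sets).\<close>

definition interval_family :: "nat \<Rightarrow> (nat \<Rightarrow> real) \<Rightarrow> real set set \<Rightarrow> bool" where
  "interval_family n X \<B> \<longleftrightarrow>
     (\<forall>B\<in>\<B>. \<exists>a \<in> X ` {1..n}. \<exists>b \<in> X ` {1..n}. a \<le> b \<and> B = {a..b})"

definition lower_bd ::
    "nat \<Rightarrow> (nat \<Rightarrow> real) \<Rightarrow> (nat \<Rightarrow> real) \<Rightarrow> real set set \<Rightarrow> (nat \<Rightarrow> nat) \<Rightarrow> real \<Rightarrow> ereal" where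
  "lower_bd n X Y \<B> cl x =
     (SUP B \<in> {B \<in> \<B>. Sup B \<le> x}. ord_stat n X Y B (cl (num_in n X B)))"

definition upper_bd ::
    "nat \<Rightarrow> (nat \<Rightarrow> real) \<Rightarrow> (nat \<Rightarrow> real) \<Rightarrow> real set set \<Rightarrow> (nat \<Rightarrow> nat) \<Rightarrow> real \<Rightarrow> ereal" where
  "upper_bd n X Y \<B> cu x =
     (INF B \<in> {B \<in> \<B>. Inf B \<ge> x}.
        ord_stat n X Y B (num_in n X B + 1 - cu (num_in n X B)))"

definition distinct_pts :: "nat \<Rightarrow> (nat \<Rightarrow> real) \<Rightarrow> real list" where
  "distinct_pts n X = sorted_list_of_set (X ` {1..n})"


section \<open>The unit-cost model\<close>

text \<open>Algorithms are programs of a while language with integer variables, integer arrays and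
  real arrays. Cells of real arrays also hold \<open>-\<infinity>\<close> and \<open>\<infinity>\<close>, as
  the values of the bounds may be infinite. Real cells admit no arithmetic: they
  are copied, compared, and used as endpoints in membership queries.
  The critical values and the family are accessible only through queries.\<close>

type_synonym name = string

datatype iexp =
    IConst int
  | IVar name
  | IArr name iexp
  | Plus iexp iexp
  | Minus iexp iexp
  | Times iexp iexp
  | Div iexp iexp
  | Mod iexp iexp
  | CritL iexp
  | CritU iexp

datatype rexp =
    NegInf
  | PosInf
  | RArr name iexp

datatype bexp =
    ILess iexp iexp
  | RLess rexp rexp
  | InFamily rexp rexp
  | BNot bexp
  | BAnd bexp bexp

datatype com =
    Skip
  | ISet name iexp
  | IStore name iexp iexp
  | RStore name iexp rexp
  | Seq com com
  | Cond bexp com com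
  | While bexp com

record state =
  ivar :: "name \<Rightarrow> int"
  iarr :: "name \<Rightarrow> int \<Rightarrow> int"
  rarr :: "name \<Rightarrow> int \<Rightarrow> ereal"

record queries =
  crit_l :: "nat \<Rightarrow> nat"
  crit_u :: "nat \<Rightarrow> nat"
  family :: "real set set"

fun ival :: "queries \<Rightarrow> iexp \<Rightarrow> state \<Rightarrow> int" where
  "ival Q (IConst k) s = k"
| "ival Q (IVar x) s = ivar s x"
| "ival Q (IArr a e) s = iarr s a (ival Q e s)"
| "ival Q (Plus e f) s = ival Q e s + ival Q f s"
| "ival Q (Minus e f) s = ival Q e s - ival Q f s"
| "ival Q (Times e f) s = ival Q e s * ival Q f s"
| "ival Q (Div e f) s = ival Q e s div ival Q f s"
| "ival Q (Mod e f) s = ival Q e s mod ival Q f s"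
| "ival Q (CritL e) s = int (crit_l Q (nat (ival Q e s)))"
| "ival Q (CritU e) s = int (crit_u Q (nat (ival Q e s)))"

fun rval :: "queries \<Rightarrow> rexp \<Rightarrow> state \<Rightarrow> ereal" where
  "rval Q NegInf s = -\<infinity>"
| "rval Q PosInf s = \<infinity>"
| "rval Q (RArr a e) s = rarr s a (ival Q e s)"

fun bval :: "queries \<Rightarrow> bexp \<Rightarrow> state \<Rightarrow> bool" where
  "bval Q (ILess e f) s \<longleftrightarrow> ival Q e s < ival Q f s"
| "bval Q (RLess u v) s \<longleftrightarrow> rval Q u s < rval Q v s"
| "bval Q (InFamily u v) s \<longleftrightarrow>
     (\<exists>a b. rval Q u s = ereal a \<and> rval Q v s = ereal b \<and> {a..b} \<in> family Q)"
| "bval Q (BNot b) s \<longleftrightarrow> \<not> bval Q b s"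
| "bval Q (BAnd b c) s \<longleftrightarrow> bval Q b s \<and> bval Q c s"

text \<open>Every operation, array access, constant and query in an expression costs one step;
  expressions are evaluated completely (no short-circuiting).\<close>

fun icost :: "iexp \<Rightarrow> nat" where
  "icost (IConst k) = 1"
| "icost (IVar x) = 1"
| "icost (IArr a e) = 1 + icost e"
| "icost (Plus e f) = 1 + icost e + icost f"
| "icost (Minus e f) = 1 + icost e + icost f"
| "icost (Times e f) = 1 + icost e + icost f"
| "icost (Div e f) = 1 + icost e + icost f"
| "icost (Mod e f) = 1 + icost e + icost f"
| "icost (CritL e) = 1 + icost e"
| "icost (CritU e) = 1 + icost e"

fun rcost :: "rexp \<Rightarrow> nat" where
  "rcost NegInf = 1"
| "rcost PosInf = 1"
| "rcost (RArr a e) = 1 + icost e"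

fun bcost :: "bexp \<Rightarrow> nat" where
  "bcost (ILess e f) = 1 + icost e + icost f"
| "bcost (RLess u v) = 1 + rcost u + rcost v"
| "bcost (InFamily u v) = 1 + rcost u + rcost v"
| "bcost (BNot b) = 1 + bcost b"
| "bcost (BAnd b c) = 1 + bcost b + bcost c"

text \<open>\<open>exec Q c s t s'\<close>: started in \<open>s\<close>, the program \<open>c\<close> halts in \<open>s'\<close> after exactly \<open>t\<close> steps.\<close>

inductive exec :: "queries \<Rightarrow> com \<Rightarrow> state \<Rightarrow> nat \<Rightarrow> state \<Rightarrow> bool" for Q where
  Skip: "exec Q Skip s 1 s"
| ISet: "exec Q (ISet x e) s (1 + icost e) (s\<lparr>ivar := (ivar s)(x := ival Q e s)\<rparr>)"
| IStore: "exec Q (IStore a e f) s (1 + icost e + icost f)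
     (s\<lparr>iarr := (iarr s)(a := (iarr s a)(ival Q e s := ival Q f s))\<rparr>)"
| RStore: "exec Q (RStore a e u) s (1 + icost e + rcost u)
     (s\<lparr>rarr := (rarr s)(a := (rarr s a)(ival Q e s := rval Q u s))\<rparr>)"
| Seq: "\<lbrakk>exec Q c s t s'; exec Q d s' t' s''\<rbrakk> \<Longrightarrow> exec Q (Seq c d) s (t + t') s''"
| IfTrue: "\<lbrakk>bval Q b s; exec Q c s t s'\<rbrakk> \<Longrightarrow> exec Q (Cond b c d) s (1 + bcost b + t) s'"
| IfFalse: "\<lbrakk>\<not> bval Q b s; exec Q d s t s'\<rbrakk> \<Longrightarrow> exec Q (Cond b c d) s (1 + bcost b + t) s'"
| WhileFalse: "\<not> bval Q b s \<Longrightarrow> exec Q (While b c) s (1 + bcost b) s"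
| WhileTrue: "\<lbrakk>bval Q b s; exec Q c s t s'; exec Q (While b c) s' t' s''\<rbrakk>
     \<Longrightarrow> exec Q (While b c) s (1 + bcost b + t + t') s''"

lemma exec_deterministic:
  "exec Q c s t s' \<Longrightarrow> exec Q c s u s'' \<Longrightarrow> u = t \<and> s'' = s'"
proof (induction arbitrary: u s'' rule: exec.induct)
  case (Seq c s t s' d t' s3)
  from Seq.prems show ?case by cases (use Seq.IH in blast)
next
  case (IfTrue b s c t s' d)
  from IfTrue.prems IfTrue.hyps(1) show ?case by cases (use IfTrue.IH in blast)+
next
  case (IfFalse b s d t s' c)
  from IfFalse.prems IfFalse.hyps(1) show ?case by cases (use IfFalse.IH in blast)+
next
  case (WhileFalse b s c)
  from WhileFalse.prems WhileFalse.hyps show ?case by cases simp_all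
next
  case (WhileTrue b s c t s' t' s3)
  from WhileTrue.prems WhileTrue.hyps(1) show ?case by cases (use WhileTrue.IH in blast)+
qed (erule exec.cases, simp_all)+

definition input_state :: "nat \<Rightarrow> (nat \<Rightarrow> real) \<Rightarrow> (nat \<Rightarrow> real) \<Rightarrow> state" where
  "input_state n X Y =
     \<lparr>ivar = (\<lambda>_. 0)(''n'' := int n),
      iarr = (\<lambda>_ _. 0),
      rarr = (\<lambda>_ _. 0)
        (''X'' := (\<lambda>i. if 1 \<le> i \<and> i \<le> int n then ereal (X (nat i)) else 0),
         ''Y'' := (\<lambda>i. if 1 \<le> i \<and> i \<le> int n then ereal (Y (nat i)) else 0))\<rparr>"

text \<open>Output convention: the variable \<open>len\<close> holds the number of distinct points, and cells
  \<open>1, \<dots>, len\<close> of the real arrays \<open>L\<close> and \<open>U\<close> hold the two vectors.\<close>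

definition output_is :: "state \<Rightarrow> ereal list \<Rightarrow> ereal list \<Rightarrow> bool" where
  "output_is s ls us \<longleftrightarrow>
     ivar s ''len'' = int (length ls) \<and> length us = length ls \<and>
     (\<forall>j \<in> {1..length ls}. rarr s ''L'' (int j) = ls ! (j - 1) \<and> rarr s ''U'' (int j) = us ! (j - 1))"

end

theory Submission
  imports Defs
begin

text \<open>
  Write \<open>z 1 < \<dots> < z l\<close> for the distinct values of the \<open>X i\<close> and \<open>w 1 < \<dots> < w m\<close> for those of
  the \<open>Y i\<close>, with sentinels \<open>w 0 = -\<infinity>\<close> and \<open>w (m + 1) = \<infinity>\<close>. Counting comparisons replaces, in
  \<open>O(n\<^sup>2)\<close> steps, every \<open>X i\<close> and \<open>Y i\<close> by its rank among the distinct values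
  (lemma \<open>run_compress\<close>).

  The order statistics need never be computed: \<open>Y\<^bsub>B:c\<^esub> \<le> w v\<close> holds iff at least \<open>c\<close> of the points
  in \<open>B\<close> have \<open>Y\<close>-rank at most \<open>v\<close>, for \<open>v \<le> m\<close> (lemma \<open>ord_stat_iff\<close>). Hence \<open>L (z k) = w (T k)\<close>, where \<open>T k\<close>
  is the least \<open>v\<close> for which all \<open>B = {z j..z k'}\<close> in the family with \<open>k' \<le> k\<close> pass this counting
  test (lemmas \<open>SUP_eq_threshold\<close> and \<open>lower_threshold\<close>). As \<open>T\<close> is monotone, all \<open>T k\<close> are found by
  one sweep with two pointers: start with \<open>k = 1\<close>, \<open>v = 0\<close>; test the intervals with right endpoint
  \<open>z k\<close>; if one of them fails, increase \<open>v\<close>, otherwise record \<open>w v\<close> as \<open>L (z k)\<close> and increase \<open>k\<close>.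
  Intervals ending further left need no new test, because they have passed for a \<open>v\<close> that was not larger. There
  are at most \<open>l + m \<le> 2 n\<close> rounds. A round costs \<open>O(n)\<close> steps: a histogram of the points over their
  \<open>X\<close>-ranks gives the counts for all \<open>j \<le> k\<close> as partial sums (lemma \<open>run_sweep\<close>).

  The bound \<open>U\<close> is the same sweep on reflected ranks. For \<open>c \<le> N\<close>, where \<open>N = N(B)\<close>, \<open>w v \<le> Y\<^bsub>B:N+1-c\<^esub>\<close> holds
  iff at least \<open>c\<close> of the points in \<open>B\<close> have \<open>Y\<close>-rank at least \<open>v\<close> (lemma \<open>upper_threshold\<close>). The binomial
  quantiles enter only through \<open>c\<^sub>\<ell> N \<le> N\<close> and \<open>c\<^sub>u N \<le> N\<close> (lemma \<open>binom_quantile_le\<close>).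
\<close>

section \<open>Runs of programs and their step counts\<close>

abbreviation I1 :: iexp where "I1 \<equiv> IConst 1"
abbreviation I0 :: iexp where "I0 \<equiv> IConst 0"
abbreviation IV :: "name \<Rightarrow> iexp" where "IV \<equiv> IVar"

text \<open>Total correctness with a step count: \<open>c\<close> halts from \<open>s\<close>, and \<open>R\<close> holds of the number of steps and
  the final state. For loop-free programs the rewrite rules below compute this symbolically; by
  determinism they are equivalences.\<close>

definition run :: "queries \<Rightarrow> com \<Rightarrow> state \<Rightarrow> (nat \<Rightarrow> state \<Rightarrow> bool) \<Rightarrow> bool" where
  "run Q c s R \<longleftrightarrow> (\<exists>t s'. exec Q c s t s' \<and> R t s')"

lemma run_Skip [simp]: "run Q Skip s R \<longleftrightarrow> R 1 s"
  unfolding run_def by (blast intro: exec.intros elim: exec.cases[of Q Skip])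

lemma run_ISet [simp]:
  "run Q (ISet x e) s R \<longleftrightarrow> R (1 + icost e) (s\<lparr>ivar := (ivar s)(x := ival Q e s)\<rparr>)"
  unfolding run_def using exec.ISet exec_deterministic by metis

lemma run_IStore [simp]:
  "run Q (IStore a e f) s R \<longleftrightarrow> R (1 + icost e + icost f)
     (s\<lparr>iarr := (iarr s)(a := (iarr s a)(ival Q e s := ival Q f s))\<rparr>)"
  unfolding run_def using exec.IStore exec_deterministic by metis

lemma run_RStore [simp]:
  "run Q (RStore a e u) s R \<longleftrightarrow> R (1 + icost e + rcost u)
     (s\<lparr>rarr := (rarr s)(a := (rarr s a)(ival Q e s := rval Q u s))\<rparr>)"
  unfolding run_def using exec.RStore exec_deterministic by metis

lemma run_Seq [simp]:
  "run Q (Seq c d) s R \<longleftrightarrow> run Q c s (\<lambda>t s'. run Q d s' (\<lambda>t'. R (t + t')))"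
proof
  assume "run Q (Seq c d) s R"
  then obtain t s' where "exec Q (Seq c d) s t s'" "R t s'" by (auto simp: run_def)
  then show "run Q c s (\<lambda>t s'. run Q d s' (\<lambda>t'. R (t + t')))"
    unfolding run_def by cases blast
qed (unfold run_def, blast intro: exec.Seq)

lemma run_Cond [simp]:
  "run Q (Cond b c d) s R \<longleftrightarrow>
     (if bval Q b s then run Q c s (\<lambda>t. R (1 + bcost b + t))
      else run Q d s (\<lambda>t. R (1 + bcost b + t)))"
proof
  assume "run Q (Cond b c d) s R"
  then obtain t s' where "exec Q (Cond b c d) s t s'" "R t s'" by (auto simp: run_def)
  then show "if bval Q b s then run Q c s (\<lambda>t. R (1 + bcost b + t))
      else run Q d s (\<lambda>t. R (1 + bcost b + t))"
    unfolding run_def by cases auto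
qed (unfold run_def, metis exec.IfTrue exec.IfFalse)

text \<open>The names that a program may assign, for each of the three kinds of storage.\<close>

fun ivar_writes :: "com \<Rightarrow> name set" where
  "ivar_writes (ISet x e) = {x}"
| "ivar_writes (Seq c d) = ivar_writes c \<union> ivar_writes d"
| "ivar_writes (Cond b c d) = ivar_writes c \<union> ivar_writes d"
| "ivar_writes (While b c) = ivar_writes c"
| "ivar_writes _ = {}"

fun iarr_writes :: "com \<Rightarrow> name set" where
  "iarr_writes (IStore a e f) = {a}"
| "iarr_writes (Seq c d) = iarr_writes c \<union> iarr_writes d"
| "iarr_writes (Cond b c d) = iarr_writes c \<union> iarr_writes d"
| "iarr_writes (While b c) = iarr_writes c"
| "iarr_writes _ = {}"

fun rarr_writes :: "com \<Rightarrow> name set" where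
  "rarr_writes (RStore a e u) = {a}"
| "rarr_writes (Seq c d) = rarr_writes c \<union> rarr_writes d"
| "rarr_writes (Cond b c d) = rarr_writes c \<union> rarr_writes d"
| "rarr_writes (While b c) = rarr_writes c"
| "rarr_writes _ = {}"

text \<open>The two states agree on all names that \<open>c\<close> does not assign. Every run of \<open>c\<close> has this property
  (lemma \<open>frame_exec\<close>), so that specifications need only mention what changes.\<close>

definition frame :: "com \<Rightarrow> state \<Rightarrow> state \<Rightarrow> bool" where
  "frame c s s' \<longleftrightarrow>
     (\<forall>x. x \<notin> ivar_writes c \<longrightarrow> ivar s' x = ivar s x) \<and>
     (\<forall>a. a \<notin> iarr_writes c \<longrightarrow> iarr s' a = iarr s a) \<and>
     (\<forall>a. a \<notin> rarr_writes c \<longrightarrow> rarr s' a = rarr s a)"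

lemma frame_refl [simp]: "frame c s s"
  by (simp add: frame_def)

lemma frame_trans: "frame c s s' \<Longrightarrow> frame c s' s'' \<Longrightarrow> frame c s s''"
  by (simp add: frame_def)

lemma frame_exec: "exec Q c s t s' \<Longrightarrow> frame c s s'"
  by (induction rule: exec.induct) (auto simp: frame_def)

lemma frame_mono:
  assumes "frame c s s'" "ivar_writes c \<subseteq> ivar_writes d" "iarr_writes c \<subseteq> iarr_writes d"
    "rarr_writes c \<subseteq> rarr_writes d"
  shows "frame d s s'"
  using assms by (auto simp: frame_def)

lemma run_mono:
  assumes "run Q c s R" and "\<And>t s'. R t s' \<Longrightarrow> frame c s s' \<Longrightarrow> R' t s'"
  shows "run Q c s R'"
  using assms frame_exec unfolding run_def by blast

text \<open>Loop rule with invariant \<open>I\<close>, variant \<open>\<mu>\<close> and a bound \<open>B\<close> on the cost of one execution of the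
  body.\<close>

lemma run_while:
  fixes \<mu> :: "state \<Rightarrow> nat"
  assumes body: "\<And>\<sigma>. I \<sigma> \<Longrightarrow> frame c s \<sigma> \<Longrightarrow> bval Q b \<sigma> \<Longrightarrow>
      run Q c \<sigma> (\<lambda>t \<sigma>'. t \<le> B \<and> I \<sigma>' \<and> \<mu> \<sigma>' < \<mu> \<sigma>)"
    and init: "I s"
    and final: "\<And>t \<sigma>. t \<le> \<mu> s * (1 + bcost b + B) + (1 + bcost b) \<Longrightarrow> I \<sigma> \<Longrightarrow>
      frame c s \<sigma> \<Longrightarrow> \<not> bval Q b \<sigma> \<Longrightarrow> R t \<sigma>"
  shows "run Q (While b c) s R"
proof -
  have "\<exists>t \<sigma>'. exec Q (While b c) \<sigma> t \<sigma>' \<and> t \<le> \<mu> \<sigma> * (1 + bcost b + B) + (1 + bcost b) \<and> I \<sigma>' \<and>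
      frame c s \<sigma>' \<and> \<not> bval Q b \<sigma>'" if "I \<sigma>" "frame c s \<sigma>" for \<sigma>
    using that
  proof (induction "\<mu> \<sigma>" arbitrary: \<sigma> rule: less_induct)
    case less
    show ?case
    proof (cases "bval Q b \<sigma>")
      case False
      then show ?thesis using less.prems exec.WhileFalse[OF False]
        by (intro exI[of _ "1 + bcost b"] exI[of _ \<sigma>]) auto
    next
      case True
      obtain t1 s1 where 1: "exec Q c \<sigma> t1 s1" "t1 \<le> B" "I s1" "\<mu> s1 < \<mu> \<sigma>"
        using body[OF less.prems True] by (auto simp: run_def)
      have "frame c s s1"
        using frame_trans[OF less.prems(2) frame_exec[OF 1(1)]] .
      from less.hyps[OF 1(4,3) this] obtain t2 s2 where 2: "exec Q (While b c) s1 t2 s2"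
        "t2 \<le> \<mu> s1 * (1 + bcost b + B) + (1 + bcost b)" "I s2" "frame c s s2" "\<not> bval Q b s2"
        by blast
      have "Suc (\<mu> s1) * (1 + bcost b + B) \<le> \<mu> \<sigma> * (1 + bcost b + B)"
        using 1(4) by (intro mult_right_mono) auto
      then have "1 + bcost b + t1 + t2 \<le> \<mu> \<sigma> * (1 + bcost b + B) + (1 + bcost b)"
        using 1(2) 2(2) by simp
      then show ?thesis using exec.WhileTrue[OF True 1(1) 2(1)] 2 by blast
    qed
  qed
  from this[OF init] final show ?thesis by (auto simp: run_def)
qed

text \<open>Counting loop: execute \<open>c\<close> for \<open>x = 1, \<dots>, y\<close>. It is meant for bodies that assign neither the
  counter \<open>x\<close> nor the variable \<open>y\<close> holding the bound.\<close>

definition For :: "name \<Rightarrow> name \<Rightarrow> com \<Rightarrow> com" where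
  "For x y c = Seq (ISet x (IConst 1)) (While (BNot (ILess (IVar y) (IVar x)))
     (Seq c (ISet x (Plus (IVar x) (IConst 1)))))"

lemma For_writes [simp]:
  "ivar_writes (For x y c) = insert x (ivar_writes c)"
  "iarr_writes (For x y c) = iarr_writes c"
  "rarr_writes (For x y c) = rarr_writes c"
  by (auto simp: For_def)

text \<open>\<open>I k\<close> holds after \<open>k\<close> rounds, at the point where the counter has the value \<open>k + 1\<close>. The constants
  \<open>9\<close> and \<open>7\<close> are the costs of the test and the increment, and of the initialisation and the final
  test.\<close>

lemma run_For:
  fixes n B :: nat
  assumes x: "x \<notin> ivar_writes c" and y: "y \<notin> ivar_writes c" and xy: "x \<noteq> y"
    and n: "ivar s y = int n"
    and init: "I 0 (s\<lparr>ivar := (ivar s)(x := 1)\<rparr>)"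
    and body: "\<And>k \<sigma>. k < n \<Longrightarrow> I k \<sigma> \<Longrightarrow> frame (For x y c) s \<sigma> \<Longrightarrow> ivar \<sigma> x = int (Suc k) \<Longrightarrow>
      run Q c \<sigma> (\<lambda>t \<sigma>'. t \<le> B \<and> I (Suc k) (\<sigma>'\<lparr>ivar := (ivar \<sigma>')(x := int (Suc (Suc k)))\<rparr>))"
    and final: "\<And>t \<sigma>. t \<le> n * (B + 9) + 7 \<Longrightarrow> I n \<sigma> \<Longrightarrow> frame (For x y c) s \<sigma> \<Longrightarrow> R t \<sigma>"
  shows "run Q (For x y c) s R"
proof -
  let ?s = "s\<lparr>ivar := (ivar s)(x := 1)\<rparr>" and ?b = "BNot (ILess (IVar y) (IVar x))"
  let ?c = "Seq c (ISet x (Plus (IVar x) (IConst 1)))"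
  define J where "J = (\<lambda>\<sigma>. \<exists>k\<le>n. ivar \<sigma> x = int (Suc k) \<and> I k \<sigma>)"
  have fr: "frame (For x y c) s \<sigma>" if "frame ?c ?s \<sigma>" for \<sigma>
    using that by (auto simp: frame_def)
  have yval: "ivar \<sigma> y = int n" if "frame ?c ?s \<sigma>" for \<sigma>
    using that x y xy n by (auto simp: frame_def)
  have "run Q (While ?b ?c) ?s (\<lambda>t'. R (1 + icost (IConst 1) + t'))"
  proof (rule run_while[where I = J and \<mu> = "\<lambda>\<sigma>. nat (int n + 1 - ivar \<sigma> x)" and B = "B + 4"])
    show "J ?s" using init by (auto simp: J_def)
  next
    fix \<sigma> assume J: "J \<sigma>" and f: "frame ?c ?s \<sigma>" and b: "bval Q ?b \<sigma>"
    obtain k where k: "ivar \<sigma> x = int (Suc k)" "I k \<sigma>" using J by (auto simp: J_def)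
    have kn: "k < n" using b k yval[OF f] by simp
    show "run Q ?c \<sigma> (\<lambda>t \<sigma>'. t \<le> B + 4 \<and> J \<sigma>' \<and>
        nat (int n + 1 - ivar \<sigma>' x) < nat (int n + 1 - ivar \<sigma> x))"
      unfolding run_Seq
    proof (rule run_mono[OF body[OF kn k(2) fr[OF f] k(1)]])
      fix t \<sigma>' assume "t \<le> B \<and> I (Suc k) (\<sigma>'\<lparr>ivar := (ivar \<sigma>')(x := int (Suc (Suc k)))\<rparr>)"
        and "frame c \<sigma> \<sigma>'"
      then show "run Q (ISet x (Plus (IVar x) (IConst 1))) \<sigma>' (\<lambda>t' \<sigma>'. t + t' \<le> B + 4 \<and> J \<sigma>' \<and>
        nat (int n + 1 - ivar \<sigma>' x) < nat (int n + 1 - ivar \<sigma> x))"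
        using k kn x by (auto simp: J_def frame_def intro!: exI[of _ "Suc k"] simp: add.commute)
    qed
  next
    fix t \<sigma> assume t: "t \<le> nat (int n + 1 - ivar ?s x) * (1 + bcost ?b + (B + 4)) + (1 + bcost ?b)"
      and J: "J \<sigma>" and f: "frame ?c ?s \<sigma>" and b: "\<not> bval Q ?b \<sigma>"
    obtain k where k: "k \<le> n" "ivar \<sigma> x = int (Suc k)" "I k \<sigma>" using J by (auto simp: J_def)
    with b yval[OF f] have "k = n" by simp
    moreover have "1 + icost (IConst 1) + t \<le> n * (B + 9) + 7" using t by (simp add: algebra_simps)
    ultimately show "R (1 + icost (IConst 1) + t) \<sigma>" using final fr[OF f] k by blast
  qed
  then show ?thesis by (simp add: For_def)
qed

section \<open>Ranks among the distinct values of a sequence\<close>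

text \<open>The rank of \<open>a\<close> among the distinct values of \<open>X 1, \<dots>, X n\<close>; it is \<open>k\<close> for the \<open>k\<close>-th smallest one.\<close>

definition rank_in :: "nat \<Rightarrow> (nat \<Rightarrow> real) \<Rightarrow> real \<Rightarrow> nat" where
  "rank_in n X a = card {x \<in> X ` {1..n}. x \<le> a}"

lemma rank_in_bounds:
  assumes "i \<in> {1..n}"
  shows "rank_in n X (X i) \<in> {1..card (X ` {1..n})}"
proof -
  have "card {X i} \<le> rank_in n X (X i)" unfolding rank_in_def
    using assms by (intro card_mono) auto
  then show ?thesis by (auto simp: rank_in_def intro!: card_mono)
qed

lemma rank_in_le_iff:
  assumes "i \<in> {1..n}" "j \<in> {1..n}"
  shows "rank_in n X (X i) \<le> rank_in n X (X j) \<longleftrightarrow> X i \<le> X j"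
proof
  assume "X i \<le> X j"
  then show "rank_in n X (X i) \<le> rank_in n X (X j)"
    unfolding rank_in_def by (intro card_mono) auto
next
  assume *: "rank_in n X (X i) \<le> rank_in n X (X j)"
  show "X i \<le> X j"
  proof (rule ccontr)
    assume "\<not> X i \<le> X j"
    then have "{x \<in> X ` {1..n}. x \<le> X j} \<subset> {x \<in> X ` {1..n}. x \<le> X i}"
      using assms by force
    then have "rank_in n X (X j) < rank_in n X (X i)"
      unfolding rank_in_def by (intro psubset_card_mono) auto
    with * show False by simp
  qed
qed

lemma rank_in_eq_iff:
  assumes "i \<in> {1..n}" "j \<in> {1..n}"
  shows "rank_in n X (X i) = rank_in n X (X j) \<longleftrightarrow> X i = X j"
  using rank_in_le_iff[OF assms, of X] rank_in_le_iff[OF assms(2,1), of X] by auto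

lemma distinct_pts_props:
  "sorted_wrt (<) (distinct_pts n X)" "set (distinct_pts n X) = X ` {1..n}"
  "length (distinct_pts n X) = card (X ` {1..n})"
  by (auto simp: distinct_pts_def)

lemma nth_rank_in:
  assumes "i \<in> {1..n}"
  shows "distinct_pts n X ! (rank_in n X (X i) - 1) = X i"
proof -
  let ?z = "distinct_pts n X"
  note p = distinct_pts_props[of n X]
  obtain k where k: "k < length ?z" "?z ! k = X i"
    using assms p(2) by (metis imageI in_set_conv_nth)
  have "{x \<in> set ?z. x \<le> X i} = (!) ?z ` {..k}"
  proof (intro equalityI subsetI)
    fix x assume "x \<in> {x \<in> set ?z. x \<le> X i}"
    then obtain l where l: "l < length ?z" "?z ! l = x" "?z ! l \<le> ?z ! k"
      using k by (auto simp: in_set_conv_nth)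
    then have "l \<le> k" using p(1) k by (metis linorder_not_less sorted_wrt_nth_less)
    then show "x \<in> (!) ?z ` {..k}" using l by auto
  next
    fix x assume "x \<in> (!) ?z ` {..k}"
    then obtain l where l: "l \<le> k" "x = ?z ! l" by auto
    then have "?z ! l \<le> ?z ! k"
      using p(1) k by (metis le_neq_implies_less less_eq_real_def sorted_wrt_nth_less)
    then show "x \<in> {x \<in> set ?z. x \<le> X i}" using l k by auto
  qed
  moreover have "inj_on ((!) ?z) {..k}"
    using k p(1) by (intro inj_on_nth) (auto simp: strict_sorted_iff)
  ultimately have "rank_in n X (X i) = Suc k"
    using p(2) by (simp add: rank_in_def card_image)
  then show ?thesis using k by simp
qed

lemma rank_in_surj:
  assumes "k \<in> {1..card (X ` {1..n})}"
  shows "\<exists>i\<in>{1..n}. rank_in n X (X i) = k \<and> X i = distinct_pts n X ! (k - 1)"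
proof -
  let ?z = "distinct_pts n X"
  note p = distinct_pts_props[of n X]
  have k: "k - 1 < length ?z" using assms p(3) by auto
  then obtain i where i: "i \<in> {1..n}" "X i = ?z ! (k - 1)"
    by (metis p(2) nth_mem imageE)
  then have "?z ! (rank_in n X (X i) - 1) = ?z ! (k - 1)" using nth_rank_in by metis
  then have "rank_in n X (X i) - 1 = k - 1"
    using k rank_in_bounds[OF i(1), of X] p
    by (subst (asm) nth_eq_iff_index_eq) (auto simp: strict_sorted_iff)
  then have "rank_in n X (X i) = k" using assms rank_in_bounds[OF i(1), of X] by auto
  then show ?thesis using i by blast
qed

text \<open>The increasing sequence of the distinct values at the indices \<open>1, 2, \<dots>\<close>, preceded by \<open>-\<infinity>\<close> at
  index \<open>0\<close> and followed by \<open>\<infinity>\<close>.\<close>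

definition sentinels :: "nat \<Rightarrow> (nat \<Rightarrow> real) \<Rightarrow> nat \<Rightarrow> ereal" where
  "sentinels n X k = (if k = 0 then -\<infinity> else if k \<le> card (X ` {1..n})
     then ereal (distinct_pts n X ! (k - 1)) else \<infinity>)"

text \<open>The \<open>j\<close>-th smallest distinct value as a real number, counted from \<open>1\<close>.\<close>

definition pt :: "nat \<Rightarrow> (nat \<Rightarrow> real) \<Rightarrow> nat \<Rightarrow> real" where
  "pt n X j = distinct_pts n X ! (j - 1)"

lemma pt_rank: "i \<in> {1..n} \<Longrightarrow> pt n X (rank_in n X (X i)) = X i"
  by (simp only: pt_def nth_rank_in)

lemma ex_pt:
  assumes "j \<in> {1..card (X ` {1..n})}"
  obtains i where "i \<in> {1..n}" "rank_in n X (X i) = j" "pt n X j = X i"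
  using rank_in_surj[OF assms] unfolding pt_def by metis

lemma pt_le_iff:
  assumes "j \<in> {1..card (X ` {1..n})}" "k \<in> {1..card (X ` {1..n})}"
  shows "pt n X j \<le> pt n X k \<longleftrightarrow> j \<le> k"
proof -
  obtain i where i: "i \<in> {1..n}" "rank_in n X (X i) = j" "pt n X j = X i"
    using ex_pt[OF assms(1)] .
  obtain i' where i': "i' \<in> {1..n}" "rank_in n X (X i') = k" "pt n X k = X i'"
    using ex_pt[OF assms(2)] .
  show ?thesis using rank_in_le_iff[OF i(1) i'(1), of X] i i' by simp
qed

lemma sentinels_pt: "k \<in> {1..card (X ` {1..n})} \<Longrightarrow> sentinels n X k = ereal (pt n X k)"
  by (simp add: sentinels_def pt_def)

lemma sentinels_rank: "i \<in> {1..n} \<Longrightarrow> sentinels n X (rank_in n X (X i)) = ereal (X i)"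
  by (simp only: sentinels_pt[OF rank_in_bounds] pt_rank)

lemma sentinels_mono:
  assumes "u \<le> v"
  shows "sentinels n X u \<le> sentinels n X v"
proof -
  have "pt n X u \<le> pt n X v" if "1 \<le> u" "v \<le> card (X ` {1..n})"
    using pt_le_iff[of u X n v] that assms by simp
  then show ?thesis using assms by (auto simp: sentinels_def pt_def)
qed

lemma le_sentinels_iff:
  assumes "i \<in> {1..n}"
  shows "ereal (X i) \<le> sentinels n X v \<longleftrightarrow> rank_in n X (X i) \<le> v"
    and "sentinels n X v \<le> ereal (X i) \<longleftrightarrow> v \<le> rank_in n X (X i)"
proof -
  note b = rank_in_bounds[OF assms, of X]
  consider "v = 0" | "v \<in> {1..card (X ` {1..n})}" | "v > card (X ` {1..n})" by force
  note c = this
  have *: "sentinels n X v = ereal (pt n X v)"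
    "X i \<le> pt n X v \<longleftrightarrow> rank_in n X (X i) \<le> v" "pt n X v \<le> X i \<longleftrightarrow> v \<le> rank_in n X (X i)"
    if "v \<in> {1..card (X ` {1..n})}"
    using sentinels_pt[OF that] pt_le_iff[OF b that] pt_le_iff[OF that b] by (simp_all add: pt_rank[OF assms])
  have "(ereal (X i) \<le> sentinels n X v \<longleftrightarrow> rank_in n X (X i) \<le> v) \<and>
      (sentinels n X v \<le> ereal (X i) \<longleftrightarrow> v \<le> rank_in n X (X i))"
  proof (cases rule: c)
    case 2
    then show ?thesis by (simp only: *[OF 2] ereal_less_eq simp_thms)
  qed (use b in \<open>auto simp: sentinels_def\<close>)
  then show "ereal (X i) \<le> sentinels n X v \<longleftrightarrow> rank_in n X (X i) \<le> v"
    "sentinels n X v \<le> ereal (X i) \<longleftrightarrow> v \<le> rank_in n X (X i)" by blast+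
qed

section \<open>Replacing data by ranks\<close>

text \<open>The indicator of \<open>i\<close> being the first index at which the value \<open>X i\<close> occurs. Sums of it count
  distinct values (lemma \<open>sum_fresh\<close>).\<close>

definition fresh :: "(nat \<Rightarrow> real) \<Rightarrow> nat \<Rightarrow> nat" where
  "fresh X i = (if \<exists>j\<in>{1..<i}. X j = X i then 0 else 1)"

lemma sum_fresh:
  "(\<Sum>j\<in>{1..n}. if P (X j) then fresh X j else 0) = card {x \<in> X ` {1..n}. P x}"
proof (induction n)
  case (Suc n)
  have S: "X ` {1..Suc n} = insert (X (Suc n)) (X ` {1..n})"
    by (simp add: atLeastAtMostSuc_conv)
  have "{x \<in> X ` {1..Suc n}. P x} =
      (if P (X (Suc n)) then insert (X (Suc n)) {x \<in> X ` {1..n}. P x} else {x \<in> X ` {1..n}. P x})"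
    unfolding S by auto
  moreover have "fresh X (Suc n) = (if X (Suc n) \<in> X ` {1..n} then 0 else 1)"
    unfolding fresh_def atLeastLessThanSuc_atLeastAtMost by (auto simp: image_iff) (metis atLeastAtMost_iff One_nat_def)+
  ultimately show ?case using Suc.IH by (auto simp: card_insert_if)
qed auto

text \<open>Stores \<open>fresh X i\<close> in the variable \<open>f\<close>, where \<open>X\<close> is the content of the real array \<open>src\<close> and \<open>i\<close>
  the value of the variable \<open>i\<close>.\<close>

definition fresh_com :: "name \<Rightarrow> com" where
  "fresh_com src = Seq (ISet ''f'' I1) (For ''j'' ''n''
     (Cond (BAnd (ILess (IV ''j'') (IV ''i''))
             (BAnd (BNot (RLess (RArr src (IV ''i'')) (RArr src (IV ''j''))))
                   (BNot (RLess (RArr src (IV ''j'')) (RArr src (IV ''i''))))))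
       (ISet ''f'' I0) Skip))"

text \<open>Stores the rank of \<open>X i\<close> in the variable \<open>f\<close>, given the values of \<open>fresh X\<close> in the array \<open>first\<close>.\<close>

definition rank_com :: "name \<Rightarrow> com" where
  "rank_com src = Seq (ISet ''f'' I0) (For ''j'' ''n''
     (Cond (BNot (RLess (RArr src (IV ''i'')) (RArr src (IV ''j''))))
       (ISet ''f'' (Plus (IV ''f'') (IArr ''first'' (IV ''j'')))) Skip))"

text \<open>Computes the number of distinct values of \<open>src\<close> in \<open>len\<close>, the rank of every entry in \<open>pos\<close>, and the
  sorted distinct values with their two sentinels in \<open>dst\<close>.\<close>

definition compress :: "name \<Rightarrow> name \<Rightarrow> name \<Rightarrow> name \<Rightarrow> com" where
  "compress src dst len pos =
     Seq (ISet len I0) (Seq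
       (For ''i'' ''n'' (Seq (fresh_com src)
          (Seq (IStore ''first'' (IV ''i'') (IV ''f'')) (ISet len (Plus (IV len) (IV ''f''))))))
     (Seq
       (For ''i'' ''n'' (Seq (rank_com src)
          (Seq (IStore pos (IV ''i'') (IV ''f'')) (RStore dst (IV ''f'') (RArr src (IV ''i''))))))
     (Seq (RStore dst I0 NegInf) (RStore dst (Plus (IV len) I1) PosInf))))"

lemma fresh_com_writes [simp]:
  "ivar_writes (fresh_com src) = {''f'', ''j''}" "iarr_writes (fresh_com src) = {}"
  "rarr_writes (fresh_com src) = {}"
  by (auto simp: fresh_com_def)

lemma rank_com_writes [simp]:
  "ivar_writes (rank_com src) = {''f'', ''j''}" "iarr_writes (rank_com src) = {}"
  "rarr_writes (rank_com src) = {}"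
  by (auto simp: rank_com_def)

lemma compress_writes [simp]:
  "ivar_writes (compress src dst len pos) = {''f'', ''j'', ''i'', len}"
  "iarr_writes (compress src dst len pos) = {''first'', pos}"
  "rarr_writes (compress src dst len pos) = {dst}"
  by (auto simp: compress_def)

lemma run_fresh_com:
  assumes n: "ivar s ''n'' = int n" and i: "ivar s ''i'' = int i" "i \<in> {1..n}"
    and X: "\<And>i. i \<in> {1..n} \<Longrightarrow> rarr s src (int i) = ereal (X i)"
  shows "run Q (fresh_com src) s (\<lambda>t s'. t \<le> 29 * n + 9 \<and> ivar s' ''f'' = int (fresh X i))"
  unfolding fresh_com_def run_Seq run_ISet
proof (rule run_For[where n = n and B = 20 and
      I = "\<lambda>k \<sigma>. ivar \<sigma> ''f'' = (if \<exists>j\<in>{1..k}. j < i \<and> X j = X i then 0 else 1)"], goal_cases)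
  case (6 k \<sigma>)
  then have "rarr \<sigma> src = rarr s src" "ivar \<sigma> ''i'' = int i"
    using i by (auto simp: frame_def)
  moreover have "rarr s src (1 + int k) = ereal (X (Suc k))"
    using X[of "Suc k"] 6 by simp
  ultimately show ?case using 6 X[OF i(2)]
    by (auto simp: atLeastAtMostSuc_conv[of 1 k, simplified] linorder_neq_iff)
next
  case (7 t \<sigma>)
  have "(\<exists>j\<in>{1..n}. j < i \<and> X j = X i) \<longleftrightarrow> (\<exists>j\<in>{1..<i}. X j = X i)"
    using i by auto
  then show ?case using 7 by (simp add: fresh_def)
qed (use n in auto)

lemma run_rank_com:
  assumes n: "ivar s ''n'' = int n" and i: "ivar s ''i'' = int i" "i \<in> {1..n}"
    and X: "\<And>i. i \<in> {1..n} \<Longrightarrow> rarr s src (int i) = ereal (X i)"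
    and first: "\<And>i. i \<in> {1..n} \<Longrightarrow> iarr s ''first'' (int i) = int (fresh X i)"
  shows "run Q (rank_com src) s (\<lambda>t s'. t \<le> 29 * n + 9 \<and> ivar s' ''f'' = int (rank_in n X (X i)))"
  unfolding rank_com_def run_Seq run_ISet
proof (rule run_For[where n = n and B = 20 and
      I = "\<lambda>k \<sigma>. ivar \<sigma> ''f'' = int (\<Sum>j\<in>{1..k}. if X j \<le> X i then fresh X j else 0)"], goal_cases)
  case (6 k \<sigma>)
  then have "rarr \<sigma> src = rarr s src" "iarr \<sigma> ''first'' = iarr s ''first''" "ivar \<sigma> ''i'' = int i"
    using i by (auto simp: frame_def)
  moreover have "rarr s src (1 + int k) = ereal (X (Suc k))"
    "iarr s ''first'' (1 + int k) = int (fresh X (Suc k))"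
    using X[of "Suc k"] first[of "Suc k"] 6 by simp_all
  ultimately show ?case using 6 X[OF i(2)]
    by auto
next
  case (7 t \<sigma>)
  then show ?case using sum_fresh[of "\<lambda>x. x \<le> X i" X n] by (simp add: rank_in_def del: of_nat_sum)
qed (use n in auto)

lemma run_compress:
  assumes n: "ivar s ''n'' = int n"
    and X: "\<And>i. i \<in> {1..n} \<Longrightarrow> rarr s src (int i) = ereal (X i)"
    and names: "src \<noteq> dst" "len \<notin> {''f'', ''j'', ''i'', ''n''}" "pos \<noteq> ''first''"
  shows "run Q (compress src dst len pos) s (\<lambda>t s'. t \<le> 200 * (n + 1)^2 \<and>
     ivar s' len = int (card (X ` {1..n})) \<and>
     (\<forall>i\<in>{1..n}. iarr s' pos (int i) = int (rank_in n X (X i))) \<and>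
     (\<forall>k\<in>{0..card (X ` {1..n}) + 1}. rarr s' dst (int k) = sentinels n X k))"
  (is "run Q _ s ?R")
proof -
  have names': "''n'' \<noteq> len" "''i'' \<noteq> len" using names by auto
  let ?m = "card (X ` {1..n})"
  let ?fr = "Seq (fresh_com src) (Seq (IStore ''first'' (IV ''i'') (IV ''f'')) (ISet len (Plus (IV len) (IV ''f''))))"
  let ?rk = "Seq (rank_com src) (Seq (IStore pos (IV ''i'') (IV ''f'')) (RStore dst (IV ''f'') (RArr src (IV ''i''))))"
  have 1: "run Q (For ''i'' ''n'' ?fr) s1 (\<lambda>t s'. t \<le> n * (29 * n + 30) + 7 \<and> ivar s' len = int ?m \<and>
       (\<forall>i\<in>{1..n}. iarr s' ''first'' (int i) = int (fresh X i)))"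
    if s1: "s1 = s\<lparr>ivar := (ivar s)(len := 0)\<rparr>" for s1
  proof (rule run_For[where n = n and B = "29 * n + 21" and
      I = "\<lambda>k \<sigma>. ivar \<sigma> len = int (\<Sum>j\<in>{1..k}. fresh X j) \<and>
         (\<forall>i\<in>{1..k}. iarr \<sigma> ''first'' (int i) = int (fresh X i))"], goal_cases)
    case (6 k \<sigma>)
    have \<sigma>: "ivar \<sigma> ''n'' = int n" "rarr \<sigma> src = rarr s src" using 6 names names' n s1
      by (simp_all add: frame_def)
    have "run Q (fresh_com src) \<sigma> (\<lambda>t s'. t \<le> 29 * n + 9 \<and> ivar s' ''f'' = int (fresh X (Suc k)))"
      by (rule run_fresh_com) (use 6 \<sigma> X in auto)
    then show ?case
      unfolding run_Seq
    proof (rule run_mono, goal_cases)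
      case (1 t \<sigma>')
      then have "ivar \<sigma>' len = ivar \<sigma> len" "iarr \<sigma>' ''first'' = iarr \<sigma> ''first''" "ivar \<sigma>' ''i'' = int (Suc k)"
        using names 6 by (simp_all add: frame_def)
      then show ?case using 1 6(2) names by (simp add: atLeastAtMostSuc_conv[of 1 k, simplified])
    qed
  next
    case (7 t \<sigma>)
    have "(\<Sum>j\<in>{1..n}. fresh X j) = ?m" using sum_fresh[of "\<lambda>_. True" X n] by simp
    then show ?case using 7 by (simp add: algebra_simps del: of_nat_sum)
  qed (use n names s1 in auto)
  have 2: "run Q (For ''i'' ''n'' ?rk) s1 (\<lambda>t s'. t \<le> n * (29 * n + 30) + 7 \<and>
       (\<forall>i\<in>{1..n}. iarr s' pos (int i) = int (rank_in n X (X i)) \<and>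
           rarr s' dst (int (rank_in n X (X i))) = ereal (X i)))"
    if n1: "ivar s1 ''n'' = int n" and X1: "rarr s1 src = rarr s src" and
      f1: "\<And>i. i \<in> {1..n} \<Longrightarrow> iarr s1 ''first'' (int i) = int (fresh X i)" for s1
  proof (rule run_For[where n = n and B = "29 * n + 21" and
      I = "\<lambda>k \<sigma>. \<forall>i\<in>{1..k}. iarr \<sigma> pos (int i) = int (rank_in n X (X i)) \<and>
           rarr \<sigma> dst (int (rank_in n X (X i))) = ereal (X i)"], goal_cases)
    case (6 k \<sigma>)
    have \<sigma>: "ivar \<sigma> ''n'' = int n" "rarr \<sigma> src = rarr s src" "iarr \<sigma> ''first'' = iarr s1 ''first''"
      using 6 names n1 X1 by (simp_all add: frame_def)
    have "run Q (rank_com src) \<sigma> (\<lambda>t s'. t \<le> 29 * n + 9 \<and> ivar s' ''f'' = int (rank_in n X (X (Suc k))))"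
      by (rule run_rank_com) (use 6 \<sigma> X f1 in auto)
    then show ?case
      unfolding run_Seq
    proof (rule run_mono, goal_cases)
      case (1 t \<sigma>')
      then have *: "iarr \<sigma>' = iarr \<sigma>" "rarr \<sigma>' = rarr \<sigma>" "ivar \<sigma>' ''i'' = int (Suc k)"
        using names 6 by (simp_all add: frame_def fun_eq_iff)
      \<comment> \<open>An index that is written again receives the same value, as equal ranks mean equal values.\<close>
      have "rank_in n X (X i) = rank_in n X (X (Suc k)) \<longleftrightarrow> X i = X (Suc k)" if "i \<in> {1..k}" for i
        using that \<open>k < n\<close> by (intro rank_in_eq_iff) auto
      moreover have "rarr s src (1 + int k) = ereal (X (Suc k))"
        using X[of "Suc k"] 6 by simp
      ultimately show ?case using 1 6(2) * \<sigma> names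
        by (simp add: atLeastAtMostSuc_conv[of 1 k, simplified])
    qed
  next
    case (7 t \<sigma>)
    then show ?case by (simp add: algebra_simps)
  qed (use n1 names in auto)
  show ?thesis
    unfolding compress_def run_Seq run_ISet ival.simps
  proof (rule run_mono[OF 1[OF refl]], goal_cases)
    case (1 t1 s1)
    then have s1: "ivar s1 ''n'' = int n" "rarr s1 src = rarr s src"
      using n names names' by (simp_all add: frame_def)
    show ?case
    proof (rule run_mono[OF 2[OF s1]], goal_cases)
      case (2 t2 s2)
      have "n * (29 * n + 30) + 7 + (n * (29 * n + 30) + 7) + 10 \<le> 200 * (n + 1)\<^sup>2"
        by (simp add: power2_eq_square algebra_simps)
      moreover have "rarr s2 dst (int k) = sentinels n X k" if "k \<in> {1..?m}" for k
        using rank_in_surj[OF that] 2(1) that by (force simp: sentinels_def)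
      moreover have "ivar s2 len = int ?m" using 1 2 names by (simp add: frame_def)
      ultimately show ?case using 1 2
        by (auto simp: sentinels_def le_Suc_eq)
    qed (use 1 in simp)
  qed
qed

section \<open>The sweep over the distinct points\<close>

text \<open>Histograms: \<open>A j\<close> counts the points \<open>i\<close> of position \<open>j\<close>, and \<open>B j\<close> those which in addition have
  height at most \<open>v\<close>. The expressions \<open>pe\<close> and \<open>re\<close> give position and height of the point \<open>i\<close>.\<close>

definition hist_com :: "iexp \<Rightarrow> iexp \<Rightarrow> com" where
  "hist_com pe re = Seq
     (For ''j'' ''len'' (Seq (IStore ''A'' (IV ''j'') I0) (IStore ''B'' (IV ''j'') I0)))
     (For ''i'' ''n'' (Seq (IStore ''A'' pe (Plus (IArr ''A'' pe) I1))
        (Cond (BNot (ILess (IV ''v'') re)) (IStore ''B'' pe (Plus (IArr ''B'' pe) I1)) Skip)))"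

text \<open>Sets \<open>bad\<close> to \<open>1\<close> if some \<open>j\<close> in \<open>1, \<dots>, k\<close> satisfies the test \<open>fe\<close>, but the number of counted
  points with positions in \<open>j, \<dots>, k\<close> is below the critical value \<open>ce\<close>, which is a function of the
  number \<open>a\<close> of all points there. The loop runs through \<open>j = k, \<dots>, 1\<close>, so that both numbers \<open>a\<close> and
  \<open>b\<close> are running sums over the histograms.\<close>

definition scan_com :: "bexp \<Rightarrow> iexp \<Rightarrow> com" where
  "scan_com fe ce = Seq (ISet ''a'' I0) (Seq (ISet ''b'' I0) (Seq (ISet ''bad'' I0)
     (For ''d'' ''k''
       (Seq (ISet ''j'' (Minus (Plus (IV ''k'') I1) (IV ''d'')))
       (Seq (ISet ''a'' (Plus (IV ''a'') (IArr ''A'' (IV ''j''))))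
       (Seq (ISet ''b'' (Plus (IV ''b'') (IArr ''B'' (IV ''j''))))
            (Cond (BAnd fe (ILess (IV ''b'') ce)) (ISet ''bad'' I1) Skip)))))))"

text \<open>The sweep with pointers \<open>k\<close> (position) and \<open>v\<close> (height). Position and height of a point, the
  interval test, the critical value and the addresses \<open>oe\<close> in the array \<open>out\<close> and \<open>we\<close> in the sorted
  array \<open>W\<close> are parameters; the sweep thus runs on the ranks or on the reflected ranks.\<close>

definition sweep :: "iexp \<Rightarrow> iexp \<Rightarrow> bexp \<Rightarrow> iexp \<Rightarrow> name \<Rightarrow> iexp \<Rightarrow> iexp \<Rightarrow> com" where
  "sweep pe re fe ce out oe we =
     Seq (ISet ''k'' I1) (Seq (ISet ''v'' I0)
     (While (BNot (ILess (IV ''len'') (IV ''k'')))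
       (Seq (hist_com pe re) (Seq (scan_com fe ce)
          (Cond (ILess I0 (IV ''bad''))
            (ISet ''v'' (Plus (IV ''v'') I1))
            (Seq (RStore out oe (RArr ''W'' we)) (ISet ''k'' (Plus (IV ''k'') I1))))))))"

lemma hist_com_writes [simp]:
  "ivar_writes (hist_com pe re) = {''i'', ''j''}" "iarr_writes (hist_com pe re) = {''A'', ''B''}"
  "rarr_writes (hist_com pe re) = {}"
  by (auto simp: hist_com_def)

lemma scan_com_writes [simp]:
  "ivar_writes (scan_com fe ce) = {''a'', ''b'', ''bad'', ''d'', ''j''}"
  "iarr_writes (scan_com fe ce) = {}" "rarr_writes (scan_com fe ce) = {}"
  by (auto simp: scan_com_def)

lemma sweep_writes [simp]:
  "ivar_writes (sweep pe re fe ce out oe we) = {''a'', ''b'', ''bad'', ''d'', ''i'', ''j'', ''k'', ''v''}"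
  "iarr_writes (sweep pe re fe ce out oe we) = {''A'', ''B''}"
  "rarr_writes (sweep pe re fe ce out oe we) = {out}"
  by (auto simp: sweep_def)

lemma run_hist_com:
  fixes p r :: "nat \<Rightarrow> nat"
  assumes n: "ivar s ''n'' = int n" and l: "ivar s ''len'' = int l" "l \<le> n"
    and v: "ivar s ''v'' = int v"
    and p: "\<And>i. i \<in> {1..n} \<Longrightarrow> p i \<in> {1..l}"
    and pe: "\<And>\<sigma> i. frame (hist_com pe re) s \<sigma> \<Longrightarrow> i \<in> {1..n} \<Longrightarrow> ivar \<sigma> ''i'' = int i \<Longrightarrow>
      ival Q pe \<sigma> = int (p i)"
    and re: "\<And>\<sigma> i. frame (hist_com pe re) s \<sigma> \<Longrightarrow> i \<in> {1..n} \<Longrightarrow> ivar \<sigma> ''i'' = int i \<Longrightarrow>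
      ival Q re \<sigma> = int (r i)"
    and cost: "icost pe \<le> 20" "icost re \<le> 20"
  shows "run Q (hist_com pe re) s (\<lambda>t s'. t \<le> 200 * n + 14 \<and>
     (\<forall>j\<in>{1..l}. iarr s' ''A'' (int j) = int (card {i \<in> {1..n}. p i = j}) \<and>
        iarr s' ''B'' (int j) = int (card {i \<in> {1..n}. p i = j \<and> r i \<le> v})))"
proof -
  have ins: "card {i \<in> {1..Suc k}. P i} = card {i \<in> {1..k}. P i} + (if P (Suc k) then 1 else 0)"
    for k and P :: "nat \<Rightarrow> bool"
  proof -
    have "{i \<in> {1..Suc k}. P i} = {i \<in> {1..k}. P i} \<union> (if P (Suc k) then {Suc k} else {})"
      by (auto simp: le_Suc_eq)
    then show ?thesis by simp
  qed
  let ?clear = "Seq (IStore ''A'' (IV ''j'') I0) (IStore ''B'' (IV ''j'') I0)"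
  let ?count = "Seq (IStore ''A'' pe (Plus (IArr ''A'' pe) I1))
        (Cond (BNot (ILess (IV ''v'') re)) (IStore ''B'' pe (Plus (IArr ''B'' pe) I1)) Skip)"
  have 1: "run Q (For ''j'' ''len'' ?clear) s (\<lambda>t \<sigma>. t \<le> 15 * n + 7 \<and>
     (\<forall>j\<in>{1..l}. iarr \<sigma> ''A'' (int j) = 0 \<and> iarr \<sigma> ''B'' (int j) = 0))"
    by (rule run_For[where n = l and B = 6 and
        I = "\<lambda>k \<sigma>. \<forall>j\<in>{1..k}. iarr \<sigma> ''A'' (int j) = 0 \<and> iarr \<sigma> ''B'' (int j) = 0"])
      (use l in \<open>auto simp: le_Suc_eq\<close>)
  show ?thesis
    unfolding hist_com_def run_Seq[of _ "For _ _ _"]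
  proof (rule run_mono[OF 1], goal_cases)
    case (1 t1 s1)
    have s1: "frame (hist_com pe re) s s1"
      using 1(2) by (rule frame_mono) auto
    show ?case
    proof (rule run_For[where n = n and B = 120 and
      I = "\<lambda>k \<sigma>. \<forall>j\<in>{1..l}. iarr \<sigma> ''A'' (int j) = int (card {i \<in> {1..k}. p i = j}) \<and>
        iarr \<sigma> ''B'' (int j) = int (card {i \<in> {1..k}. p i = j \<and> r i \<le> v})"], goal_cases)
      case (6 k \<sigma>)
      have f: "frame (hist_com pe re) s \<sigma>"
        using s1 by (rule frame_trans) (rule frame_mono[OF 6(3)], auto)
      have k: "Suc k \<in> {1..n}" using 6 by simp
      define \<sigma>1 where "\<sigma>1 = \<sigma>\<lparr>iarr := (iarr \<sigma>)(''A'' := (iarr \<sigma> ''A'')(int (p (Suc k)) := iarr \<sigma> ''A'' (int (p (Suc k))) + 1))\<rparr>"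
      have f1: "frame (hist_com pe re) s \<sigma>1"
        using f by (auto simp: \<sigma>1_def frame_def)
      have i1: "ivar \<sigma>1 ''i'' = int (Suc k)" using 6 by (simp add: \<sigma>1_def)
      have v: "ivar \<sigma>1 ''v'' = int v" using f1 v by (simp add: frame_def)
      note vals = pe[OF f k 6(4)] pe[OF f1 k i1] re[OF f1 k i1]
      have step: "run Q ?count \<sigma> R \<longleftrightarrow> run Q (Cond (BNot (ILess (IV ''v'') re)) (IStore ''B'' pe (Plus (IArr ''B'' pe) I1)) Skip) \<sigma>1
         (\<lambda>t. R (1 + icost pe + (2 + icost pe + 1) + t))" for R
        by (simp add: \<sigma>1_def vals)
      have A1: "iarr \<sigma>1 ''A'' (int j) = int (card {i \<in> {1..Suc k}. p i = j})" if "j \<in> {1..l}" for j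
        using bspec[OF 6(2) that] unfolding ins by (auto simp: \<sigma>1_def simp del: atLeastAtMost_iff One_nat_def)
      have B1: "iarr \<sigma>1 ''B'' (int j) = int (card {i \<in> {1..k}. p i = j \<and> r i \<le> v})" if "j \<in> {1..l}" for j
        using bspec[OF 6(2) that] by (simp add: \<sigma>1_def)
      have B2: "card {i \<in> {1..Suc k}. p i = j \<and> r i \<le> v} =
          card {i \<in> {1..k}. p i = j \<and> r i \<le> v} + (if p (Suc k) = j \<and> r (Suc k) \<le> v then 1 else 0)" for j
        unfolding ins by simp
      show ?case unfolding step using cost A1 B1 p[OF k]
        by (simp add: vals v B2 del: atLeastAtMost_iff One_nat_def)
    next
      case (7 t \<sigma>)
      then show ?case using 1 by auto
    qed (use n 1 l in \<open>auto simp: frame_def\<close>)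
  qed
qed

lemma run_scan_com:
  fixes \<alpha> \<beta> c :: "nat \<Rightarrow> nat" and F :: "nat \<Rightarrow> bool"
  assumes k: "ivar s ''k'' = int k"
    and A: "\<And>j. j \<in> {1..k} \<Longrightarrow> iarr s ''A'' (int j) = int (\<alpha> j)"
    and B: "\<And>j. j \<in> {1..k} \<Longrightarrow> iarr s ''B'' (int j) = int (\<beta> j)"
    and fe: "\<And>\<sigma> j. frame (scan_com fe ce) s \<sigma> \<Longrightarrow> j \<in> {1..k} \<Longrightarrow> ivar \<sigma> ''j'' = int j \<Longrightarrow>
      bval Q fe \<sigma> = F j"
    and ce: "\<And>\<sigma> N. frame (scan_com fe ce) s \<sigma> \<Longrightarrow> ivar \<sigma> ''a'' = int N \<Longrightarrow> ival Q ce \<sigma> = int (c N)"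
    and cost: "bcost fe \<le> 20" "icost ce \<le> 20"
  shows "run Q (scan_com fe ce) s (\<lambda>t s'. t \<le> 100 * k + 13 \<and>
     ivar s' ''bad'' = (if \<exists>j\<in>{1..k}. F j \<and> sum \<beta> {j..k} < c (sum \<alpha> {j..k}) then 1 else 0))"
  unfolding scan_com_def run_Seq[of _ "ISet _ I0"] run_ISet[of _ _ I0]
proof (rule run_For[where n = k and B = 80 and
      I = "\<lambda>d \<sigma>. ivar \<sigma> ''a'' = int (sum \<alpha> {k + 1 - d..k}) \<and> ivar \<sigma> ''b'' = int (sum \<beta> {k + 1 - d..k}) \<and>
         ivar \<sigma> ''bad'' = (if \<exists>j\<in>{k + 1 - d..k}. F j \<and> sum \<beta> {j..k} < c (sum \<alpha> {j..k}) then 1 else 0)"],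
    goal_cases)
  case (6 d \<sigma>)
  define j where "j = k - d"
  have j: "j \<in> {1..k}" "int k + 1 - int (Suc d) = int j" "k + 1 - d = Suc j" "k + 1 - Suc d = j"
    using 6(1) by (auto simp: j_def)
  have sets: "{j..k} = insert j {Suc j..k}" using j by auto
  have f: "frame (scan_com fe ce) s \<sigma>" using 6(3) by (auto simp: frame_def)
  define \<sigma>1 where "\<sigma>1 = \<sigma>\<lparr>ivar := (ivar \<sigma>)(''j'' := int j, ''a'' := int (sum \<alpha> {j..k}), ''b'' := int (sum \<beta> {j..k}))\<rparr>"
  have f1: "frame (scan_com fe ce) s \<sigma>1" using f by (auto simp: \<sigma>1_def frame_def)
  have AB: "iarr \<sigma> ''A'' (int j) = int (\<alpha> j)" "iarr \<sigma> ''B'' (int j) = int (\<beta> j)" "ivar \<sigma> ''k'' = int k"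
    using f A[OF j(1)] B[OF j(1)] k by (simp_all add: frame_def)
  have vals: "bval Q fe \<sigma>1 = F j" "ival Q ce \<sigma>1 = int (c (sum \<alpha> {j..k}))"
    by (intro fe[OF f1 j(1)] ce[OF f1], simp add: \<sigma>1_def)+
  let ?ej = "Minus (Plus (IV ''k'') I1) (IV ''d'')"
  let ?ea = "Plus (IV ''a'') (IArr ''A'' (IV ''j''))"
  let ?eb = "Plus (IV ''b'') (IArr ''B'' (IV ''j''))"
  have step: "run Q (Seq (ISet ''j'' ?ej) (Seq (ISet ''a'' ?ea) (Seq (ISet ''b'' ?eb) e))) \<sigma> R \<longleftrightarrow>
      run Q e \<sigma>1 (\<lambda>t. R (1 + icost ?ej + (1 + icost ?ea + (1 + icost ?eb + t))))" for e R
  proof -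
    have "\<sigma>1 = \<sigma>\<lparr>ivar := (ivar \<sigma>)(''j'' := int j, ''a'' := ivar \<sigma> ''a'' + iarr \<sigma> ''A'' (int j),
        ''b'' := ivar \<sigma> ''b'' + iarr \<sigma> ''B'' (int j))\<rparr>"
      using 6(2) j(3) AB by (simp add: \<sigma>1_def sets add.commute)
    then show ?thesis using j(2) 6(4) AB by simp
  qed
  define bad where "bad = (\<lambda>j. F j \<and> sum \<beta> {j..k} < c (sum \<alpha> {j..k}))"
  have b1: "ivar \<sigma>1 ''bad'' = (if \<exists>j\<in>{Suc j..k}. bad j then 1 else 0)"
    using 6(2) j(3) by (simp add: \<sigma>1_def bad_def)
  have b2: "(\<exists>j\<in>{j..k}. bad j) \<longleftrightarrow> bad j \<or> (\<exists>j\<in>{Suc j..k}. bad j)"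
    unfolding sets by simp
  have ab: "ivar \<sigma>1 ''a'' = int (sum \<alpha> {j..k})" "ivar \<sigma>1 ''b'' = int (sum \<beta> {j..k})"
    by (simp_all add: \<sigma>1_def)
  have cond: "bval Q (BAnd fe (ILess (IV ''b'') ce)) \<sigma>1 \<longleftrightarrow> bad j"
    by (simp add: vals ab bad_def del: of_nat_sum)
  show ?case
    unfolding step run_Cond cond j(4) bad_def[symmetric] b2
    using cost b1 ab by (simp del: of_nat_sum)
next
  case (7 t \<sigma>)
  then show ?case by simp
qed (use k in auto)

lemma sum_card_fibres:
  assumes "finite I" "finite J"
  shows "(\<Sum>j\<in>J. card {i \<in> I. p i = j \<and> P i}) = card {i \<in> I. p i \<in> J \<and> P i}"
  using assms(2)
proof (induction J rule: finite_induct)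
  case (insert j J)
  have "{i \<in> I. p i \<in> insert j J \<and> P i} = {i \<in> I. p i = j \<and> P i} \<union> {i \<in> I. p i \<in> J \<and> P i}" by auto
  moreover have "card \<dots> = card {i \<in> I. p i = j \<and> P i} + card {i \<in> I. p i \<in> J \<and> P i}"
    using assms(1) insert by (intro card_Un_disjoint) auto
  ultimately show ?case using insert by simp
qed simp


text \<open>Here \<open>ok v j k\<close> says that the interval with end positions \<open>j\<close> and \<open>k\<close> passes the counting test at
  height \<open>v\<close>, and \<open>T k\<close> is the least height at which all intervals with right end at most \<open>k\<close> pass.
  The counts are those of all points \<open>i\<close> with position \<open>p i\<close> in the interval, and of those which in
  addition have height \<open>r i \<le> v\<close>. The meaning of \<open>ce\<close> is required in every state, that of the
  other parameter expressions in the states that agree with the initial one on all names not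
  assigned by the sweep.\<close>

lemma run_sweep:
  fixes n l m :: nat and p r c T oi wi :: "nat \<Rightarrow> nat" and F :: "nat \<Rightarrow> nat \<Rightarrow> bool"
  defines "ok \<equiv> \<lambda>v j k. F j k \<longrightarrow>
      c (card {i \<in> {1..n}. p i \<in> {j..k}}) \<le> card {i \<in> {1..n}. p i \<in> {j..k} \<and> r i \<le> v}"
  assumes n: "ivar s ''n'' = int n" and l: "ivar s ''len'' = int l" "l \<le> n" and m: "m \<le> n"
    and p: "\<And>i. i \<in> {1..n} \<Longrightarrow> p i \<in> {1..l}"
    and T: "\<And>k. k \<in> {1..l} \<Longrightarrow> T k \<le> m"
      "\<And>k v. k \<in> {1..l} \<Longrightarrow> v \<le> m \<Longrightarrow> T k \<le> v \<longleftrightarrow> (\<forall>k'\<in>{1..k}. \<forall>j\<in>{1..k'}. ok v j k')"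
    and out: "out \<noteq> ''W''" and oi: "inj_on oi {1..l}"
    and pe: "\<And>\<sigma> i. frame (sweep pe re fe ce out oe we) s \<sigma> \<Longrightarrow> i \<in> {1..n} \<Longrightarrow> ivar \<sigma> ''i'' = int i \<Longrightarrow>
      ival Q pe \<sigma> = int (p i)"
    and re: "\<And>\<sigma> i. frame (sweep pe re fe ce out oe we) s \<sigma> \<Longrightarrow> i \<in> {1..n} \<Longrightarrow> ivar \<sigma> ''i'' = int i \<Longrightarrow>
      ival Q re \<sigma> = int (r i)"
    and fe: "\<And>\<sigma> j k. frame (sweep pe re fe ce out oe we) s \<sigma> \<Longrightarrow> j \<in> {1..k} \<Longrightarrow> k \<le> l \<Longrightarrow>
      ivar \<sigma> ''j'' = int j \<Longrightarrow> ivar \<sigma> ''k'' = int k \<Longrightarrow> bval Q fe \<sigma> = F j k"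
    and ce: "\<And>\<sigma> N. ivar \<sigma> ''a'' = int N \<Longrightarrow> ival Q ce \<sigma> = int (c N)"
    and oe: "\<And>\<sigma> k. frame (sweep pe re fe ce out oe we) s \<sigma> \<Longrightarrow> k \<in> {1..l} \<Longrightarrow> ivar \<sigma> ''k'' = int k \<Longrightarrow>
      ival Q oe \<sigma> = int (oi k)"
    and we: "\<And>\<sigma> v. frame (sweep pe re fe ce out oe we) s \<sigma> \<Longrightarrow> v \<le> m \<Longrightarrow> ivar \<sigma> ''v'' = int v \<Longrightarrow>
      ival Q we \<sigma> = int (wi v)"
    and cost: "icost pe \<le> 20" "icost re \<le> 20" "bcost fe \<le> 20" "icost ce \<le> 20" "icost oe \<le> 20"
      "icost we \<le> 20"
  shows "run Q (sweep pe re fe ce out oe we) s (\<lambda>t s'. t \<le> 1000 * (n + 1)^2 \<and>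
     (\<forall>k\<in>{1..l}. rarr s' out (int (oi k)) = rarr s ''W'' (int (wi (T k)))))"
proof -
  let ?sw = "sweep pe re fe ce out oe we"
  let ?s = "s\<lparr>ivar := (ivar s)(''k'' := 1, ''v'' := 0)\<rparr>"
  let ?test = "Cond (ILess I0 (IV ''bad'')) (ISet ''v'' (Plus (IV ''v'') I1))
            (Seq (RStore out oe (RArr ''W'' we)) (ISet ''k'' (Plus (IV ''k'') I1)))"
  let ?body = "Seq (hist_com pe re) (Seq (scan_com fe ce) ?test)"
  \<comment> \<open>The value \<open>0\<close> at position \<open>0\<close> makes the first round an instance of the general invariant.\<close>
  define T' where "T' = (\<lambda>k. if k = 0 then 0 else T k)"
  \<comment> \<open>The height \<open>v\<close> lies between the thresholds of positions \<open>k - 1\<close> and \<open>k\<close>.\<close>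
  define inv where "inv = (\<lambda>(\<sigma>::state) k v. ivar \<sigma> ''k'' = int k \<and> ivar \<sigma> ''v'' = int v \<and> k \<in> {1..l + 1} \<and> v \<le> m \<and>
      T' (k - 1) \<le> v \<and> (k \<le> l \<longrightarrow> v \<le> T k) \<and>
      (\<forall>k'\<in>{1..<k}. rarr \<sigma> out (int (oi k')) = rarr s ''W'' (int (wi (T k')))))"
  \<comment> \<open>Each round increases \<open>k\<close> or \<open>v\<close>, which bounds the number of rounds by \<open>l + m\<close>.\<close>
  define \<mu> where "\<mu> = (\<lambda>\<sigma>::state. nat (int l + 1 - ivar \<sigma> ''k'') + nat (int m - ivar \<sigma> ''v''))"
  have fr: "frame ?sw s \<sigma>" if "frame ?body ?s \<sigma>" for \<sigma>
    using that by (auto simp: frame_def)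
  have "run Q (While (BNot (ILess (IV ''len'') (IV ''k''))) ?body) ?s
     (\<lambda>t s'. 4 + t \<le> 1000 * (n + 1)^2 \<and>
     (\<forall>k\<in>{1..l}. rarr s' out (int (oi k)) = rarr s ''W'' (int (wi (T k)))))"
  proof (rule run_while[where I = "\<lambda>\<sigma>. \<exists>k v. inv \<sigma> k v" and \<mu> = \<mu> and B = "300 * n + 100"])
    show "\<exists>k v. inv ?s k v"
      by (rule exI[of _ 1], rule exI[of _ 0]) (use n in \<open>auto simp: inv_def T'_def\<close>)
  next
    fix t \<sigma>
    assume t: "t \<le> \<mu> ?s * (1 + bcost (BNot (ILess (IV ''len'') (IV ''k''))) + (300 * n + 100)) +
        (1 + bcost (BNot (ILess (IV ''len'') (IV ''k''))))"
      and I: "\<exists>k v. inv \<sigma> k v" and f: "frame ?body ?s \<sigma>"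
      and b: "\<not> bval Q (BNot (ILess (IV ''len'') (IV ''k''))) \<sigma>"
    obtain k v where kv: "inv \<sigma> k v" using I by auto
    have "ivar \<sigma> ''len'' = int l" using fr[OF f] l by (simp add: frame_def)
    with b kv have "k = l + 1" by (auto simp: inv_def)
    moreover have "4 + t \<le> 1000 * (n + 1)^2"
    proof -
      have "\<mu> ?s \<le> 2 * n" using l m by (simp add: \<mu>_def)
      then have "\<mu> ?s * (300 * n + 105) \<le> 2 * n * (300 * n + 105)" by (rule mult_right_mono) simp
      moreover have "t \<le> \<mu> ?s * (300 * n + 105) + 5" using t by (simp add: add.commute)
      ultimately have "4 + t \<le> 2 * n * (300 * n + 105) + 9" by linarith
      also have "\<dots> \<le> 1000 * (n + 1)^2" by (simp add: power2_eq_square algebra_simps)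
      finally show ?thesis .
    qed
    ultimately show "4 + t \<le> 1000 * (n + 1)^2 \<and>
        (\<forall>k\<in>{1..l}. rarr \<sigma> out (int (oi k)) = rarr s ''W'' (int (wi (T k))))"
      using kv by (auto simp: inv_def)
  next
    fix \<sigma>
    assume I: "\<exists>k v. inv \<sigma> k v" and f: "frame ?body ?s \<sigma>"
      and b: "bval Q (BNot (ILess (IV ''len'') (IV ''k''))) \<sigma>"
    obtain k v where kv: "inv \<sigma> k v" using I by auto
    note fs = fr[OF f]
    have \<sigma>: "ivar \<sigma> ''n'' = int n" "ivar \<sigma> ''len'' = int l" "rarr \<sigma> ''W'' = rarr s ''W''"
      using fs n l out by (simp_all add: frame_def)
    have k: "k \<in> {1..l}" "ivar \<sigma> ''k'' = int k" and v: "ivar \<sigma> ''v'' = int v" "v \<le> m"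
      and Tv: "T' (k - 1) \<le> v" "v \<le> T k"
      and stored: "\<forall>k'\<in>{1..<k}. rarr \<sigma> out (int (oi k')) = rarr s ''W'' (int (wi (T k')))"
      using kv b \<sigma> by (auto simp: inv_def)
    let ?\<alpha> = "\<lambda>j. card {i \<in> {1..n}. p i = j}" and ?\<beta> = "\<lambda>j. card {i \<in> {1..n}. p i = j \<and> r i \<le> v}"
    show "run Q ?body \<sigma> (\<lambda>t \<sigma>'. t \<le> 300 * n + 100 \<and> (\<exists>k v. inv \<sigma>' k v) \<and> \<mu> \<sigma>' < \<mu> \<sigma>)"
      unfolding run_Seq[of _ "hist_com pe re"]
    proof (rule run_mono)
      show "run Q (hist_com pe re) \<sigma> (\<lambda>t s'. t \<le> 200 * n + 14 \<and>
         (\<forall>j\<in>{1..l}. iarr s' ''A'' (int j) = int (?\<alpha> j) \<and> iarr s' ''B'' (int j) = int (?\<beta> j)))"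
      proof (rule run_hist_com[OF \<sigma>(1,2) l(2) v(1) p])
        fix \<sigma>' i assume "frame (hist_com pe re) \<sigma> \<sigma>'" "i \<in> {1..n}" "ivar \<sigma>' ''i'' = int i"
        moreover from this(1) have "frame ?sw s \<sigma>'"
          by (rule frame_trans[OF fs frame_mono]) auto
        ultimately show "ival Q pe \<sigma>' = int (p i)" "ival Q re \<sigma>' = int (r i)"
          using pe re by blast+
      qed (use cost in auto)
    next
      fix t1 s1
      assume h: "t1 \<le> 200 * n + 14 \<and>
         (\<forall>j\<in>{1..l}. iarr s1 ''A'' (int j) = int (?\<alpha> j) \<and> iarr s1 ''B'' (int j) = int (?\<beta> j))"
        and f1: "frame (hist_com pe re) \<sigma> s1"
      have fs1: "frame ?sw s s1"
        using f1 by (rule frame_trans[OF fs frame_mono]) auto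
      have k1: "ivar s1 ''k'' = int k" "ivar s1 ''v'' = int v" using f1 k v by (simp_all add: frame_def)
      define bad where "bad \<longleftrightarrow> (\<exists>j\<in>{1..k}. \<not> ok v j k)"
      have scan: "run Q (scan_com fe ce) s1 (\<lambda>t s'. t \<le> 100 * k + 13 \<and> ivar s' ''bad'' = (if bad then 1 else 0))"
      proof -
        have "run Q (scan_com fe ce) s1 (\<lambda>t s'. t \<le> 100 * k + 13 \<and>
          ivar s' ''bad'' = (if \<exists>j\<in>{1..k}. F j k \<and> sum ?\<beta> {j..k} < c (sum ?\<alpha> {j..k}) then 1 else 0))"
        proof (rule run_scan_com[OF k1(1)])
          fix \<sigma>' j assume "frame (scan_com fe ce) s1 \<sigma>'" "j \<in> {1..k}" "ivar \<sigma>' ''j'' = int j"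
          moreover from this(1) have "frame ?sw s \<sigma>'"
            by (rule frame_trans[OF fs1 frame_mono]) auto
          moreover from calculation(1) have "ivar \<sigma>' ''k'' = int k"
            using k1 by (simp add: frame_def)
          ultimately show "bval Q fe \<sigma>' = F j k" using fe k by auto
        qed (use cost h k ce in auto)
        then show ?thesis
          using sum_card_fibres[where I = "{1..n}" and p = p and P = "\<lambda>_. True"]
            sum_card_fibres[where I = "{1..n}" and p = p and P = "\<lambda>i. r i \<le> v"]
          by (simp add: bad_def ok_def not_le)
      qed
      show "run Q (Seq (scan_com fe ce) ?test) s1
         (\<lambda>t'. (\<lambda>t \<sigma>'. t \<le> 300 * n + 100 \<and> (\<exists>k v. inv \<sigma>' k v) \<and> \<mu> \<sigma>' < \<mu> \<sigma>) (t1 + t'))"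
        unfolding run_Seq[of _ "scan_com fe ce"]
      proof (rule run_mono[OF scan])
        fix t2 s2
        assume g: "t2 \<le> 100 * k + 13 \<and> ivar s2 ''bad'' = (if bad then 1 else 0)"
          and f2: "frame (scan_com fe ce) s1 s2"
        have fs2: "frame ?sw s s2"
          using f2 by (rule frame_trans[OF fs1 frame_mono]) auto
        have k2: "ivar s2 ''k'' = int k" "ivar s2 ''v'' = int v" "rarr s2 = rarr \<sigma>" "rarr s2 ''W'' = rarr s ''W''"
          using f1 f2 k1 \<sigma> by (simp_all add: frame_def fun_eq_iff)
        have time: "t1 + (t2 + 73) \<le> 300 * n + 100" using h g k l by auto
        \<comment> \<open>Intervals ending before position \<open>k\<close> pass at height \<open>v\<close> since \<open>T (k - 1) \<le> v\<close>.\<close>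
        have Tk: "T k \<le> v \<longleftrightarrow> \<not> bad"
        proof
          assume "T k \<le> v"
          then show "\<not> bad" using T(2)[OF k(1) v(2)] k by (auto simp: bad_def)
        next
          assume nb: "\<not> bad"
          have "\<forall>k'\<in>{1..k}. \<forall>j\<in>{1..k'}. ok v j k'"
          proof (intro ballI)
            fix k' j assume kj: "k' \<in> {1..k}" "j \<in> {1..k'}"
            show "ok v j k'"
            proof (cases "k' = k")
              case True
              then show ?thesis using nb kj by (auto simp: bad_def)
            next
              case False
              then have "k - 1 \<in> {1..l}" "k' \<in> {1..k - 1}" using kj k by auto
              moreover from this have "T (k - 1) \<le> v" using Tv(1) by (auto simp: T'_def split: if_splits)
              ultimately show ?thesis using T(2)[of "k - 1" v] v kj by blast
            qed
          qed
          then show "T k \<le> v" using T(2)[OF k(1) v(2)] by simp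
        qed
        show "run Q ?test s2
          (\<lambda>t'. (\<lambda>t'. (\<lambda>t \<sigma>'. t \<le> 300 * n + 100 \<and> (\<exists>k v. inv \<sigma>' k v) \<and> \<mu> \<sigma>' < \<mu> \<sigma>) (t1 + t')) (t2 + t'))"
        proof (cases bad)
          case True
          have vT: "v < T k" "T k \<le> m" using True Tk T(1)[OF k(1)] by auto
          let ?s3 = "s2\<lparr>ivar := (ivar s2)(''v'' := int v + 1)\<rparr>"
          have "inv ?s3 k (Suc v)" using kv k2 vT by (auto simp: inv_def)
          moreover have "\<mu> ?s3 < \<mu> \<sigma>" using vT k2 k v by (simp add: \<mu>_def)
          ultimately show ?thesis using True g k2 time by auto
        next
          case False
          then have vT: "v = T k" using Tk Tv by simp
          let ?s3 = "s2\<lparr>rarr := (rarr s2)(out := (rarr s2 out)(int (oi k) := rarr s ''W'' (int (wi v)))),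
            ivar := (ivar s2)(''k'' := int k + 1)\<rparr>"
          have vals: "ival Q oe s2 = int (oi k)" "ival Q we s2 = int (wi v)"
            using oe[OF fs2 k(1) k2(1)] we[OF fs2 v(2) k2(2)] by auto
          have next_T: "T k \<le> T (Suc k)" if "Suc k \<le> l"
          proof -
            have "\<forall>k'\<in>{1..Suc k}. \<forall>j\<in>{1..k'}. ok (T (Suc k)) j k'"
              using T(2)[of "Suc k" "T (Suc k)"] T(1)[of "Suc k"] that by auto
            then show ?thesis using T(2)[of k "T (Suc k)"] T(1)[of "Suc k"] that k by auto
          qed
          have oi': "oi k' \<noteq> oi k" if "k' \<in> {1..<k}" for k'
            using inj_onD[OF oi, of k' k] that k by auto
          have "inv ?s3 (Suc k) v"
            unfolding inv_def
          proof (intro conjI ballI)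
            fix k' assume k': "k' \<in> {1..<Suc k}"
            show "rarr ?s3 out (int (oi k')) = rarr s ''W'' (int (wi (T k')))"
              using k' vT oi'[of k'] stored k2 by (cases "k' = k") auto
          qed (use k k2 v vT next_T in \<open>auto simp: T'_def\<close>)
          moreover have "\<mu> ?s3 < \<mu> \<sigma>" using k2 k v by (simp add: \<mu>_def)
          moreover have "rarr s2 ''W'' (int (wi v)) = rarr s ''W'' (int (wi v))" using k2 by simp
          ultimately show ?thesis using False g k2 time cost vals out by auto
        qed
      qed
    qed
  qed
  then show ?thesis by (simp add: sweep_def) (erule run_mono, simp)
qed

section \<open>Order statistics, quantiles and thresholds\<close>

text \<open>In a sorted list, the elements satisfying a downward closed predicate form an initial segment.\<close>

lemma nth_sorted_iff:
  assumes "sorted xs" "\<And>x y. x \<le> y \<Longrightarrow> P y \<Longrightarrow> P x" "k < length xs"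
  shows "P (xs ! k) \<longleftrightarrow> k < length (filter P xs)"
  using assms(1,3)
proof (induction xs arbitrary: k)
  case (Cons x xs)
  show ?case
  proof (cases "P x")
    case True
    then show ?thesis using Cons by (cases k) auto
  next
    case False
    then have "\<not> P y" if "y \<in> set xs" for y
      using Cons.prems(1) assms(2)[of x y] that by auto
    then have "filter P (x # xs) = []" using False by (simp add: filter_empty_conv)
    moreover have "\<not> P ((x # xs) ! k)"
      using \<open>\<And>y. y \<in> set xs \<Longrightarrow> \<not> P y\<close> False Cons.prems(2) by (cases k) auto
    ultimately show ?thesis by simp
  qed
qed simp

lemma length_filter_points:
  "length (filter P (map Y (filter (\<lambda>i. X i \<in> B) [1..<Suc n]))) = card {i \<in> {1..n}. X i \<in> B \<and> P (Y i)}"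
proof -
  have "length (filter P (map Y (filter (\<lambda>i. X i \<in> B) [1..<Suc n]))) =
      length (filter (\<lambda>i. X i \<in> B \<and> P (Y i)) [1..<Suc n])"
    by (simp add: filter_map o_def del: upt_Suc)
  also have "\<dots> = card {i \<in> set [1..<Suc n]. X i \<in> B \<and> P (Y i)}"
    by (subst distinct_length_filter) (auto intro: arg_cong[where f = card])
  finally show ?thesis by (simp only: set_upt atLeastLessThanSuc_atLeastAtMost)
qed

text \<open>Order statistics are compared with a value by counting. The predicate \<open>P\<close> stands for \<open>\<le> y\<close> or
  \<open>< y\<close>; its values at \<open>-\<infinity>\<close> and \<open>\<infinity>\<close> match the conventions for the indices \<open>0\<close> and \<open>N(B) + 1\<close>.\<close>

lemma ord_stat_iff:
  assumes down: "\<And>x y. x \<le> y \<Longrightarrow> P y \<Longrightarrow> P x" and "P (-\<infinity>)" "\<not> P \<infinity>"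
  shows "P (ord_stat n X Y B k) \<longleftrightarrow> k \<le> card {i \<in> {1..n}. X i \<in> B \<and> P (ereal (Y i))}"
proof -
  let ?ys = "map Y (filter (\<lambda>i. X i \<in> B) [1..<Suc n])"
  have len: "length ?ys = num_in n X B"
    using length_filter_points[of "\<lambda>_. True" Y X B n] by (simp add: num_in_def)
  have cnt: "length (filter (\<lambda>y. P (ereal y)) (sort ?ys)) = card {i \<in> {1..n}. X i \<in> B \<and> P (ereal (Y i))}"
    using length_filter_points[of "\<lambda>y. P (ereal y)" Y X B n]
    by (simp only: filter_sort length_sort)
  have le: "card {i \<in> {1..n}. X i \<in> B \<and> P (ereal (Y i))} \<le> num_in n X B"
    unfolding num_in_def by (intro card_mono) auto
  consider "k = 0" | "k \<in> {1..num_in n X B}" | "k > num_in n X B" by force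
  then show ?thesis
  proof cases
    case 2
    have "P (ereal (sort ?ys ! (k - 1))) \<longleftrightarrow> k - 1 < length (filter (\<lambda>y. P (ereal y)) (sort ?ys))"
    proof (rule nth_sorted_iff)
      show "P (ereal x)" if "x \<le> y" "P (ereal y)" for x y
        using down[of "ereal x" "ereal y"] that by simp
    qed (use 2 len in auto)
    then show ?thesis using 2 cnt unfolding ord_stat_def by auto
  qed (use assms le in \<open>auto simp: ord_stat_def\<close>)
qed

lemma ord_stat_range:
  assumes "k \<le> num_in n X B"
  shows "ord_stat n X Y B k = -\<infinity> \<or> (\<exists>i\<in>{1..n}. ord_stat n X Y B k = ereal (Y i))"
proof (cases "k = 0")
  case False
  let ?ys = "map Y (filter (\<lambda>i. X i \<in> B) [1..<Suc n])"
  have "length ?ys = num_in n X B"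
    using length_filter_points[of "\<lambda>_. True" Y X B n] by (simp add: num_in_def)
  then have "sort ?ys ! (k - 1) \<in> set (sort ?ys)"
    using False assms by (intro nth_mem) simp
  then show ?thesis using False assms by (auto simp: ord_stat_def)
qed (simp add: ord_stat_def)

lemma binom_quantile_le:
  assumes "0 \<le> p" "p \<le> 1" "\<kappa> \<le> 1"
  shows "binom_quantile m p \<kappa> \<le> m"
proof -
  have "set_pmf (binomial_pmf m p) \<subseteq> {..m}"
    using assms by (auto simp: set_pmf_binomial_eq)
  then have "binom_cdf m p m = 1"
    unfolding binom_cdf_def by (subst measure_pmf.prob_eq_1) (auto simp: AE_measure_pmf_iff)
  then have "m \<in> {k \<in> {0..m}. binom_cdf m p k \<ge> \<kappa>}" using assms by simp
  then show ?thesis unfolding binom_quantile_def by (intro Min_le) auto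
qed

text \<open>A supremum of values taken from a finite increasing sequence \<open>w 0 = -\<infinity>, \<dots>, w m\<close> is the term whose
  index is the least one that dominates all of them.\<close>

lemma SUP_eq_threshold:
  fixes w :: "nat \<Rightarrow> ereal" and h :: "'a \<Rightarrow> ereal"
  assumes mono: "\<And>u v. u \<le> v \<Longrightarrow> v \<le> m \<Longrightarrow> w u \<le> w v" and w0: "w 0 = -\<infinity>"
    and h: "\<And>b. b \<in> K \<Longrightarrow> h b \<in> w ` {0..m}"
  defines "T \<equiv> LEAST v. \<forall>b\<in>K. h b \<le> w v"
  shows "T \<le> m" and "(SUP b\<in>K. h b) = w T"
    and "v \<le> m \<Longrightarrow> T \<le> v \<longleftrightarrow> (\<forall>b\<in>K. h b \<le> w v)"
proof -
  have "\<forall>b\<in>K. h b \<le> w m" using h mono by (force)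
  then have T: "\<forall>b\<in>K. h b \<le> w T" and Tm: "T \<le> m"
    unfolding T_def by (rule LeastI, rule Least_le)
  show "T \<le> m" by fact
  show "T \<le> v \<longleftrightarrow> (\<forall>b\<in>K. h b \<le> w v)" if "v \<le> m"
    using T mono[of T v] that Least_le[of "\<lambda>v. \<forall>b\<in>K. h b \<le> w v" v] unfolding T_def
    by (meson order_trans)
  show "(SUP b\<in>K. h b) = w T"
  proof (rule antisym)
    show "w T \<le> (SUP b\<in>K. h b)"
    proof (cases "T = 0")
      case False
      then have "\<not> (\<forall>b\<in>K. h b \<le> w (T - 1))"
        using not_less_Least[of "T - 1" "\<lambda>v. \<forall>b\<in>K. h b \<le> w v"] by (simp add: T_def)
      then obtain b where b: "b \<in> K" "\<not> h b \<le> w (T - 1)" by auto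
      obtain u where u: "u \<le> m" "h b = w u" using h[OF b(1)] by auto
      have "T - 1 \<le> m" using Tm by linarith
      then have "\<not> u \<le> T - 1" using mono[of u "T - 1"] u b by auto
      then have "w T \<le> h b" using mono[of T u] u by simp
      then show ?thesis using b(1) by (rule SUP_upper2[rotated])
    qed (simp add: w0)
  qed (use T in \<open>auto intro: SUP_least\<close>)
qed

section \<open>Both bounds as thresholds\<close>

lemma mem_pts_iff:
  assumes "j \<in> {1..card (X ` {1..n})}" "k \<in> {1..card (X ` {1..n})}" "i \<in> {1..n}"
  shows "X i \<in> {pt n X j..pt n X k} \<longleftrightarrow> rank_in n X (X i) \<in> {j..k}"
  using pt_le_iff[OF assms(1) rank_in_bounds[OF assms(3)]]
    pt_le_iff[OF rank_in_bounds[OF assms(3)] assms(2)]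
  by (simp add: pt_rank[OF assms(3)])

lemma num_in_pts:
  assumes "1 \<le> j" "j \<le> k" "k \<le> card (X ` {1..n})"
  shows "num_in n X {pt n X j..pt n X k} = card {i \<in> {1..n}. rank_in n X (X i) \<in> {j..k}}"
    and "num_in n X {pt n X j..pt n X k} \<in> {1..n}"
proof -
  show "num_in n X {pt n X j..pt n X k} = card {i \<in> {1..n}. rank_in n X (X i) \<in> {j..k}}"
    unfolding num_in_def using assms by (intro arg_cong[where f = card] Collect_cong conj_cong mem_pts_iff) auto
  obtain i where i: "i \<in> {1..n}" "rank_in n X (X i) = j" "pt n X j = X i"
    using ex_pt[of j X n] assms by auto
  have "X i \<in> {pt n X j..pt n X k}"
    using mem_pts_iff[of j X n k i] assms i by auto
  then have "{i} \<subseteq> {i \<in> {1..n}. X i \<in> {pt n X j..pt n X k}}" using i by blast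
  then have "card {i} \<le> num_in n X {pt n X j..pt n X k}"
    unfolding num_in_def by (intro card_mono) auto
  moreover have "num_in n X {pt n X j..pt n X k} \<le> card {1..n}"
    unfolding num_in_def by (intro card_mono) auto
  ultimately show "num_in n X {pt n X j..pt n X k} \<in> {1..n}" by simp
qed

text \<open>Every member of the family is given by the ranks of its endpoints.\<close>

lemma interval_family_pts:
  assumes "interval_family n X \<B>" "B \<in> \<B>"
  obtains j k where "1 \<le> j" "j \<le> k" "k \<le> card (X ` {1..n})" "B = {pt n X j..pt n X k}"
proof -
  have "\<exists>a\<in>X ` {1..n}. \<exists>b\<in>X ` {1..n}. a \<le> b \<and> B = {a..b}"
    using bspec[OF assms(1)[unfolded interval_family_def] assms(2)] .
  then obtain i i' where i: "i \<in> {1..n}" "i' \<in> {1..n}" "X i \<le> X i'" "B = {X i..X i'}"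
    by (elim bexE conjE imageE) (simp only:)
  show thesis
    using that[of "rank_in n X (X i)" "rank_in n X (X i')"] i rank_in_bounds[OF i(1), of X]
      rank_in_bounds[OF i(2), of X] rank_in_le_iff[OF i(1,2), of X] pt_rank[OF i(1)] pt_rank[OF i(2)]
    by simp
qed

text \<open>The lower bound at the \<open>k\<close>-th point is the value of rank \<open>T k\<close>, with \<open>T\<close> the threshold required by
  the sweep; \<open>p\<close> and \<open>r\<close> are the ranks.\<close>

lemma lower_threshold:
  fixes n X Y
  defines "l \<equiv> card (X ` {1..n})" and "m \<equiv> card (Y ` {1..n})"
    and "p \<equiv> \<lambda>i. rank_in n X (X i)" and "r \<equiv> \<lambda>i. rank_in n Y (Y i)"
  assumes fam: "interval_family n X \<B>" and cl: "\<And>N. N \<in> {1..n} \<Longrightarrow> cl N \<le> N"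
  shows "\<exists>T. \<forall>k\<in>{1..l}. T k \<le> m \<and> lower_bd n X Y \<B> cl (pt n X k) = sentinels n Y (T k) \<and>
     (\<forall>v\<le>m. T k \<le> v \<longleftrightarrow> (\<forall>k'\<in>{1..k}. \<forall>j\<in>{1..k'}. {pt n X j..pt n X k'} \<in> \<B> \<longrightarrow>
        cl (card {i \<in> {1..n}. p i \<in> {j..k'}}) \<le> card {i \<in> {1..n}. p i \<in> {j..k'} \<and> r i \<le> v}))"
proof (rule bchoice, intro ballI)
  fix k assume k: "k \<in> {1..l}"
  let ?I = "\<lambda>(j, k). {pt n X j..pt n X k}"
  define K where "K = {(j, k'). 1 \<le> j \<and> j \<le> k' \<and> k' \<le> k \<and> ?I (j, k') \<in> \<B>}"
  define h where "h = (\<lambda>b. ord_stat n X Y (?I b) (cl (num_in n X (?I b))))"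
  let ?w = "sentinels n Y"
  have sets: "{B \<in> \<B>. Sup B \<le> pt n X k} = ?I ` K"
  proof (intro equalityI subsetI)
    fix B assume B: "B \<in> {B \<in> \<B>. Sup B \<le> pt n X k}"
    obtain j k' where j: "1 \<le> j" "j \<le> k'" "k' \<le> card (X ` {1..n})" "B = {pt n X j..pt n X k'}"
      using interval_family_pts[OF fam, of B] B by blast
    have "pt n X j \<le> pt n X k'" using pt_le_iff[of j X n k'] j by simp
    then have "pt n X k' \<le> pt n X k" using B j by simp
    then have "k' \<le> k" using pt_le_iff[of k' X n k] j k by (simp add: l_def)
    then show "B \<in> ?I ` K" using j B by (auto simp: K_def)
  next
    fix B assume "B \<in> ?I ` K"
    then obtain j k' where j: "1 \<le> j" "j \<le> k'" "k' \<le> k" "B = {pt n X j..pt n X k'}" "B \<in> \<B>"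
      by (auto simp: K_def)
    then have "pt n X j \<le> pt n X k'" "pt n X k' \<le> pt n X k"
      using pt_le_iff[of j X n k'] pt_le_iff[of k' X n k] k by (simp_all add: l_def)
    then show "B \<in> {B \<in> \<B>. Sup B \<le> pt n X k}" using j by simp
  qed
  have lower: "lower_bd n X Y \<B> cl (pt n X k) = (SUP b\<in>K. h b)"
    by (simp only: lower_bd_def sets image_image h_def)
  have hw: "h b \<in> ?w ` {0..m}" if bK: "b \<in> K" for b
  proof -
    obtain j k' where b: "b = (j, k')" "1 \<le> j" "j \<le> k'" "k' \<le> l" using bK k by (auto simp: K_def)
    have "cl (num_in n X (?I b)) \<le> num_in n X (?I b)"
      using num_in_pts(2)[of j k' X n] b cl by (simp add: l_def)
    from ord_stat_range[OF this, of Y] have "h b = -\<infinity> \<or> (\<exists>i\<in>{1..n}. h b = ereal (Y i))"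
      by (simp add: h_def)
    then show ?thesis
    proof
      assume "h b = -\<infinity>"
      then show ?thesis by (intro image_eqI[of _ _ 0]) (auto simp: sentinels_def)
    next
      assume "\<exists>i\<in>{1..n}. h b = ereal (Y i)"
      then obtain i where "i \<in> {1..n}" "h b = ereal (Y i)" by blast
      then show ?thesis using rank_in_bounds[of i n Y] sentinels_rank[of i n Y]
        by (intro image_eqI[of _ _ "rank_in n Y (Y i)"]) (auto simp: m_def)
    qed
  qed
  have h_le: "h (j, k') \<le> ?w v \<longleftrightarrow>
      cl (card {i \<in> {1..n}. p i \<in> {j..k'}}) \<le> card {i \<in> {1..n}. p i \<in> {j..k'} \<and> r i \<le> v}"
    if "1 \<le> j" "j \<le> k'" "k' \<le> l" "v \<le> m" for j k' v
  proof -
    have "h (j, k') \<le> ?w v \<longleftrightarrow> cl (num_in n X (?I (j, k'))) \<le>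
        card {i \<in> {1..n}. X i \<in> ?I (j, k') \<and> ereal (Y i) \<le> ?w v}"
      unfolding h_def by (rule ord_stat_iff) (use that in \<open>auto simp: sentinels_def m_def\<close>)
    also have "{i \<in> {1..n}. X i \<in> ?I (j, k') \<and> ereal (Y i) \<le> ?w v} =
        {i \<in> {1..n}. p i \<in> {j..k'} \<and> r i \<le> v}"
      unfolding p_def r_def prod.case using that
      by (intro Collect_cong conj_cong mem_pts_iff le_sentinels_iff refl) (auto simp: l_def)
    finally show ?thesis using num_in_pts(1)[of j k' X n] that by (simp add: p_def l_def)
  qed
  have w0: "?w 0 = -\<infinity>" by (simp add: sentinels_def)
  note thr = SUP_eq_threshold[of m ?w K h, OF sentinels_mono w0 hw]
  show "\<exists>T\<le>m. lower_bd n X Y \<B> cl (pt n X k) = ?w T \<and>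
     (\<forall>v\<le>m. T \<le> v \<longleftrightarrow> (\<forall>k'\<in>{1..k}. \<forall>j\<in>{1..k'}. {pt n X j..pt n X k'} \<in> \<B> \<longrightarrow>
        cl (card {i \<in> {1..n}. p i \<in> {j..k'}}) \<le> card {i \<in> {1..n}. p i \<in> {j..k'} \<and> r i \<le> v}))"
  proof (intro exI conjI allI impI)
    fix v assume v: "v \<le> m"
    have "(LEAST v. \<forall>b\<in>K. h b \<le> ?w v) \<le> v \<longleftrightarrow> (\<forall>b\<in>K. h b \<le> ?w v)"
      by (rule thr(3)) (use v in auto)
    also have "\<dots> \<longleftrightarrow> (\<forall>k'\<in>{1..k}. \<forall>j\<in>{1..k'}. {pt n X j..pt n X k'} \<in> \<B> \<longrightarrow> h (j, k') \<le> ?w v)"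
      by (auto simp: K_def)
    also have "\<dots> \<longleftrightarrow> (\<forall>k'\<in>{1..k}. \<forall>j\<in>{1..k'}. {pt n X j..pt n X k'} \<in> \<B> \<longrightarrow>
        cl (card {i \<in> {1..n}. p i \<in> {j..k'}}) \<le> card {i \<in> {1..n}. p i \<in> {j..k'} \<and> r i \<le> v})"
      using h_le v k by (intro ball_cong refl) auto
    finally show "(LEAST v. \<forall>b\<in>K. h b \<le> ?w v) \<le> v \<longleftrightarrow> \<dots>" .
  next
    show "lower_bd n X Y \<B> cl (pt n X k) = ?w (LEAST v. \<forall>b\<in>K. h b \<le> ?w v)"
      unfolding lower by (rule thr(2))
  qed (rule thr(1))
qed

text \<open>The analogue for the upper bound, in reflected coordinates: \<open>p\<close> and \<open>r\<close> are the ranks counted from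
  above, and \<open>(j, k)\<close> denotes the interval from point \<open>l + 1 - k\<close> to point \<open>l + 1 - j\<close>. The infimum
  is the negative of a supremum of negated order statistics, so \<open>SUP_eq_threshold\<close> applies to the
  negated and reversed sequence of values.\<close>

lemma upper_threshold:
  fixes n X Y
  defines "l \<equiv> card (X ` {1..n})" and "m \<equiv> card (Y ` {1..n})"
    and "p \<equiv> \<lambda>i. card (X ` {1..n}) + 1 - rank_in n X (X i)"
    and "r \<equiv> \<lambda>i. card (Y ` {1..n}) + 1 - rank_in n Y (Y i)"
  assumes fam: "interval_family n X \<B>" and cu: "\<And>N. N \<in> {1..n} \<Longrightarrow> cu N \<le> N"
  shows "\<exists>T. \<forall>k\<in>{1..l}. T k \<le> m \<and>
     upper_bd n X Y \<B> cu (pt n X (l + 1 - k)) = sentinels n Y (m + 1 - T k) \<and>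
     (\<forall>v\<le>m. T k \<le> v \<longleftrightarrow> (\<forall>k'\<in>{1..k}. \<forall>j\<in>{1..k'}.
        {pt n X (l + 1 - k')..pt n X (l + 1 - j)} \<in> \<B> \<longrightarrow>
        cu (card {i \<in> {1..n}. p i \<in> {j..k'}}) \<le> card {i \<in> {1..n}. p i \<in> {j..k'} \<and> r i \<le> v}))"
proof (rule bchoice, intro ballI)
  fix k assume k: "k \<in> {1..l}"
  let ?I = "\<lambda>(j, k). {pt n X (l + 1 - k)..pt n X (l + 1 - j)}"
  define K where "K = {(j, k'). 1 \<le> j \<and> j \<le> k' \<and> k' \<le> k \<and> ?I (j, k') \<in> \<B>}"
  define o\<^sub>u where "o\<^sub>u = (\<lambda>b. ord_stat n X Y (?I b) (num_in n X (?I b) + 1 - cu (num_in n X (?I b))))"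
  define h where "h = (\<lambda>b. - o\<^sub>u b)"
  define w where "w = (\<lambda>v. - sentinels n Y (m + 1 - v))"
  have pt_le: "pt n X i \<le> pt n X j \<longleftrightarrow> i \<le> j" if "i \<in> {1..l}" "j \<in> {1..l}" for i j
    using pt_le_iff that unfolding l_def .
  have refl_in: "l + 1 - i \<in> {1..l}" if "i \<in> {1..l}" for i using that by auto
  have sets: "{B \<in> \<B>. Inf B \<ge> pt n X (l + 1 - k)} = ?I ` K"
  proof (intro equalityI subsetI)
    fix B assume B: "B \<in> {B \<in> \<B>. Inf B \<ge> pt n X (l + 1 - k)}"
    obtain j k' where j: "1 \<le> j" "j \<le> k'" "k' \<le> card (X ` {1..n})" "B = {pt n X j..pt n X k'}"
      using interval_family_pts[OF fam, of B] B by blast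
    then have jl: "j \<in> {1..l}" "k' \<in> {1..l}" by (auto simp: l_def)
    have "pt n X j \<le> pt n X k'" using pt_le[OF jl] j by simp
    then have "pt n X (l + 1 - k) \<le> pt n X j" using B j by simp
    then have "l + 1 - k \<le> j" using pt_le[OF refl_in[OF k] jl(1)] by simp
    then have "(l + 1 - k', l + 1 - j) \<in> K" "?I (l + 1 - k', l + 1 - j) = B"
      using j B k by (auto simp: K_def l_def)
    then show "B \<in> ?I ` K" by (metis imageI)
  next
    fix B assume "B \<in> ?I ` K"
    then obtain j k' where j: "1 \<le> j" "j \<le> k'" "k' \<le> k" "B = {pt n X (l + 1 - k')..pt n X (l + 1 - j)}" "B \<in> \<B>"
      by (auto simp: K_def)
    then have jl: "j \<in> {1..l}" "k' \<in> {1..l}" using k by auto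
    have "pt n X (l + 1 - k') \<le> pt n X (l + 1 - j)" "pt n X (l + 1 - k) \<le> pt n X (l + 1 - k')"
      using pt_le[OF refl_in[OF jl(2)] refl_in[OF jl(1)]] pt_le[OF refl_in[OF k] refl_in[OF jl(2)]] j
      by simp_all
    then show "B \<in> {B \<in> \<B>. Inf B \<ge> pt n X (l + 1 - k)}" using j by simp
  qed
  have upper: "upper_bd n X Y \<B> cu (pt n X (l + 1 - k)) = - (SUP b\<in>K. h b)"
    by (simp only: upper_bd_def sets image_image h_def o\<^sub>u_def ereal_SUP_uminus_eq ereal_uminus_uminus)
  have I: "1 \<le> l + 1 - k'" "l + 1 - k' \<le> l + 1 - j" "l + 1 - j \<le> l"
      "num_in n X (?I (j, k')) = card {i \<in> {1..n}. p i \<in> {j..k'}}"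
      "num_in n X (?I (j, k')) \<in> {1..n}"
      "\<And>i. i \<in> {1..n} \<Longrightarrow> X i \<in> ?I (j, k') \<longleftrightarrow> p i \<in> {j..k'}"
    if jk: "1 \<le> j" "j \<le> k'" "k' \<le> l" for j k'
  proof -
    show b: "1 \<le> l + 1 - k'" "l + 1 - k' \<le> l + 1 - j" "l + 1 - j \<le> l" using jk by auto
    have refl_iff: "rank_in n X (X i) \<in> {l + 1 - k'..l + 1 - j} \<longleftrightarrow> p i \<in> {j..k'}" if "i \<in> {1..n}" for i
      using rank_in_bounds[OF that, of X] jk by (auto simp: p_def l_def)
    show mem: "X i \<in> ?I (j, k') \<longleftrightarrow> p i \<in> {j..k'}" if "i \<in> {1..n}" for i
      using mem_pts_iff[of "l + 1 - k'" X n "l + 1 - j" i] refl_iff[OF that] that b by (simp add: l_def)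
    show "num_in n X (?I (j, k')) = card {i \<in> {1..n}. p i \<in> {j..k'}}"
      unfolding num_in_def using mem by (intro arg_cong[where f = card] Collect_cong conj_cong refl)
    show "num_in n X (?I (j, k')) \<in> {1..n}"
      using num_in_pts(2)[of "l + 1 - k'" "l + 1 - j" X n] b by (simp add: l_def)
  qed
  have hw: "h b \<in> w ` {0..m}" if bK: "b \<in> K" for b
  proof -
    obtain j k' where b: "b = (j, k')" "1 \<le> j" "j \<le> k'" "k' \<le> l" using bK k by (auto simp: K_def)
    note N = I(5)[OF b(2-4)]
    show ?thesis
    proof (cases "cu (num_in n X (?I b)) = 0")
      case True
      then have "h b = w 0" using b by (simp add: h_def o\<^sub>u_def w_def ord_stat_def sentinels_def m_def)
      then show ?thesis by auto
    next
      case False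
      let ?c = "num_in n X (?I b) + 1 - cu (num_in n X (?I b))"
      have c: "?c \<le> num_in n X (?I b)" using False by linarith
      have "?c \<noteq> 0" using cu[OF N] unfolding b(1) by linarith
      then have "ord_stat n X Y (?I b) ?c \<noteq> -\<infinity>" by (simp add: ord_stat_def)
      then obtain i where i: "i \<in> {1..n}" "o\<^sub>u b = ereal (Y i)"
        using ord_stat_range[OF c, of Y] unfolding o\<^sub>u_def by blast
      note ri = rank_in_bounds[OF i(1), of Y]
      have "m + 1 - r i = rank_in n Y (Y i)" using ri by (simp add: r_def m_def)
      then have "h b = w (r i)"
        by (simp only: h_def w_def i(2) sentinels_rank[OF i(1)])
      then show ?thesis using ri by (auto simp: r_def m_def)
    qed
  qed
  have h_le: "h (j, k') \<le> w v \<longleftrightarrow>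
      cu (card {i \<in> {1..n}. p i \<in> {j..k'}}) \<le> card {i \<in> {1..n}. p i \<in> {j..k'} \<and> r i \<le> v}"
    if jk: "1 \<le> j" "j \<le> k'" "k' \<le> l" and v: "v \<le> m" for j k' v
  proof -
    let ?J = "?I (j, k')" and ?y = "sentinels n Y (m + 1 - v)"
    let ?N = "num_in n X ?J"
    let ?lt = "{i \<in> {1..n}. X i \<in> ?J \<and> ereal (Y i) < ?y}"
    let ?ge = "{i \<in> {1..n}. p i \<in> {j..k'} \<and> r i \<le> v}"
    have ge: "?ge = {i \<in> {1..n}. X i \<in> ?J \<and> \<not> ereal (Y i) < ?y}"
    proof (intro Collect_cong conj_cong refl)
      fix i assume i: "i \<in> {1..n}"
      show "p i \<in> {j..k'} \<longleftrightarrow> X i \<in> ?J" using I(6)[OF jk i] by simp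
      show "r i \<le> v \<longleftrightarrow> \<not> ereal (Y i) < ?y"
        using rank_in_bounds[OF i, of Y] le_sentinels_iff(2)[OF i, of Y "m + 1 - v"] v
        by (auto simp: r_def m_def not_less)
    qed
    have "{i \<in> {1..n}. X i \<in> ?J} = ?lt \<union> ?ge" unfolding ge by blast
    then have "?N = card (?lt \<union> ?ge)" unfolding num_in_def by (rule arg_cong)
    also have "\<dots> = card ?lt + card ?ge"
    proof (rule card_Un_disjoint)
      show "?lt \<inter> ?ge = {}" unfolding ge by blast
    qed simp_all
    finally have N: "?N = card ?lt + card ?ge" .
    have "h (j, k') \<le> w v \<longleftrightarrow> \<not> o\<^sub>u (j, k') < ?y"
      by (simp add: h_def w_def not_less)
    also have "o\<^sub>u (j, k') < ?y \<longleftrightarrow> ?N + 1 - cu ?N \<le> card ?lt"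
      unfolding o\<^sub>u_def by (rule ord_stat_iff[where P = "\<lambda>x. x < ?y"]) (use v in \<open>auto simp: sentinels_def\<close>)
    also have "(\<not> ?N + 1 - cu ?N \<le> card ?lt) \<longleftrightarrow> cu ?N \<le> card ?ge" using N cu[OF I(5)[OF jk]] by linarith
    finally show ?thesis by (simp only: I(4)[OF jk])
  qed
  have mono: "w u \<le> w v" if "u \<le> v" for u v
    unfolding w_def using that by (simp add: sentinels_mono)
  have w0: "w 0 = -\<infinity>" by (simp add: w_def sentinels_def m_def)
  note thr = SUP_eq_threshold[of m w K h, OF mono w0 hw]
  show "\<exists>T\<le>m. upper_bd n X Y \<B> cu (pt n X (l + 1 - k)) = sentinels n Y (m + 1 - T) \<and>
     (\<forall>v\<le>m. T \<le> v \<longleftrightarrow> (\<forall>k'\<in>{1..k}. \<forall>j\<in>{1..k'}.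
        {pt n X (l + 1 - k')..pt n X (l + 1 - j)} \<in> \<B> \<longrightarrow>
        cu (card {i \<in> {1..n}. p i \<in> {j..k'}}) \<le> card {i \<in> {1..n}. p i \<in> {j..k'} \<and> r i \<le> v}))"
  proof (intro exI conjI allI impI)
    fix v assume v: "v \<le> m"
    have "(LEAST v. \<forall>b\<in>K. h b \<le> w v) \<le> v \<longleftrightarrow> (\<forall>b\<in>K. h b \<le> w v)"
      by (rule thr(3)) (use v in auto)
    also have "\<dots> \<longleftrightarrow> (\<forall>k'\<in>{1..k}. \<forall>j\<in>{1..k'}. ?I (j, k') \<in> \<B> \<longrightarrow> h (j, k') \<le> w v)"
      by (auto simp: K_def)
    also have "\<dots> \<longleftrightarrow> (\<forall>k'\<in>{1..k}. \<forall>j\<in>{1..k'}. {pt n X (l + 1 - k')..pt n X (l + 1 - j)} \<in> \<B> \<longrightarrow>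
        cu (card {i \<in> {1..n}. p i \<in> {j..k'}}) \<le> card {i \<in> {1..n}. p i \<in> {j..k'} \<and> r i \<le> v})"
      using h_le v k by (intro ball_cong refl) auto
    finally show "(LEAST v. \<forall>b\<in>K. h b \<le> w v) \<le> v \<longleftrightarrow> \<dots>" .
  next
    have sup: "(SUP b\<in>K. h b) = w (LEAST v. \<forall>b\<in>K. h b \<le> w v)" by (rule thr(2))
    show "upper_bd n X Y \<B> cu (pt n X (l + 1 - k)) = sentinels n Y (m + 1 - (LEAST v. \<forall>b\<in>K. h b \<le> w v))"
      unfolding upper sup unfolding w_def by (rule ereal_uminus_uminus)
  qed (rule thr(1))
qed

section \<open>The algorithm\<close>

text \<open>The sweep for the lower bounds, run on the ranks.\<close>

definition sweep_up :: com where
  "sweep_up = sweep (IArr ''P'' (IV ''i'')) (IArr ''R'' (IV ''i''))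
     (InFamily (RArr ''Z'' (IV ''j'')) (RArr ''Z'' (IV ''k''))) (CritL (IV ''a''))
     ''L'' (IV ''k'') (IV ''v'')"

text \<open>Reflection \<open>e \<mapsto> b + 1 - e\<close> of indices, for a variable \<open>b\<close>.\<close>

abbreviation mirror :: "name \<Rightarrow> iexp \<Rightarrow> iexp" where
  "mirror b e \<equiv> Minus (Plus (IV b) I1) e"

text \<open>The sweep for the upper bounds, run on the reflected ranks; it fills \<open>U\<close> from the last cell to the
  first one.\<close>

definition sweep_down :: com where
  "sweep_down = sweep (mirror ''len'' (IArr ''P'' (IV ''i''))) (mirror ''m'' (IArr ''R'' (IV ''i'')))
     (InFamily (RArr ''Z'' (mirror ''len'' (IV ''k''))) (RArr ''Z'' (mirror ''len'' (IV ''j'')))) (CritU (IV ''a''))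
     ''U'' (mirror ''len'' (IV ''k'')) (mirror ''m'' (IV ''v''))"

text \<open>The state after both data sequences have been replaced by ranks. It contains all data that the
  sweeps use, and no sweep destroys it.\<close>

definition prepared :: "nat \<Rightarrow> (nat \<Rightarrow> real) \<Rightarrow> (nat \<Rightarrow> real) \<Rightarrow> state \<Rightarrow> bool" where
  "prepared n X Y s \<longleftrightarrow> ivar s ''n'' = int n \<and>
     ivar s ''len'' = int (card (X ` {1..n})) \<and> ivar s ''m'' = int (card (Y ` {1..n})) \<and>
     (\<forall>i\<in>{1..n}. iarr s ''P'' (int i) = int (rank_in n X (X i)) \<and>
        iarr s ''R'' (int i) = int (rank_in n Y (Y i))) \<and>
     (\<forall>k\<in>{1..card (X ` {1..n})}. rarr s ''Z'' (int k) = ereal (pt n X k)) \<and>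
     (\<forall>k\<in>{0..card (Y ` {1..n}) + 1}. rarr s ''W'' (int k) = sentinels n Y k)"

lemma card_image_le_n: "card (X ` {1..n}) \<le> n"
  using card_image_le[of "{1..n}" X] by simp

lemma run_sweep_up:
  assumes s: "prepared n X Y s"
    and fam: "interval_family n X (family Q)" and c: "\<And>N. N \<in> {1..n} \<Longrightarrow> crit_l Q N \<le> N"
  shows "run Q sweep_up s (\<lambda>t s'. t \<le> 1000 * (n + 1)\<^sup>2 \<and>
     (\<forall>k\<in>{1..card (X ` {1..n})}. rarr s' ''L'' (int k) = lower_bd n X Y (family Q) (crit_l Q) (pt n X k)))"
proof -
  let ?l = "card (X ` {1..n})" and ?m = "card (Y ` {1..n})"
  obtain T where T: "\<forall>k\<in>{1..?l}. T k \<le> ?m \<and>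
     lower_bd n X Y (family Q) (crit_l Q) (pt n X k) = sentinels n Y (T k) \<and>
     (\<forall>v\<le>?m. T k \<le> v \<longleftrightarrow> (\<forall>k'\<in>{1..k}. \<forall>j\<in>{1..k'}. {pt n X j..pt n X k'} \<in> family Q \<longrightarrow>
        crit_l Q (card {i \<in> {1..n}. rank_in n X (X i) \<in> {j..k'}}) \<le>
        card {i \<in> {1..n}. rank_in n X (X i) \<in> {j..k'} \<and> rank_in n Y (Y i) \<le> v}))"
    using lower_threshold[OF fam, of "crit_l Q" Y] c by blast
  have fr: "prepared n X Y \<sigma>" if "frame sweep_up s \<sigma>" for \<sigma>
    using s that by (simp add: prepared_def frame_def sweep_up_def)
  note fr' = fr[unfolded sweep_up_def]
  have Tm: "T k \<le> ?m" if "k \<in> {1..?l}" for k using T that by blast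
  have "run Q sweep_up s (\<lambda>t s'. t \<le> 1000 * (n + 1)\<^sup>2 \<and>
     (\<forall>k\<in>{1..?l}. rarr s' ''L'' (int k) = rarr s ''W'' (int (T k))))"
    unfolding sweep_up_def
  proof (rule run_sweep[where m = ?m and p = "\<lambda>i. rank_in n X (X i)" and r = "\<lambda>i. rank_in n Y (Y i)" and
        T = T and oi = "\<lambda>k. k" and wi = "\<lambda>v. v" and F = "\<lambda>j k. {pt n X j..pt n X k} \<in> family Q" and c = "crit_l Q"], goal_cases)
    case (7 k v)
    then show ?case using T by blast
  next
    case (10 \<sigma> i)
    then show ?case using fr'[OF 10(1)] by (simp add: prepared_def)
  next
    case (11 \<sigma> i)
    then show ?case using fr'[OF 11(1)] by (simp add: prepared_def)
  next
    case (12 \<sigma> j k)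
    then have "rarr \<sigma> ''Z'' (int j) = ereal (pt n X j)" "rarr \<sigma> ''Z'' (int k) = ereal (pt n X k)"
      using fr'[OF 12(1)] by (auto simp: prepared_def)
    then show ?case using 12 by simp
  qed (use s Tm rank_in_bounds[of _ n X] card_image_le_n in \<open>auto simp: prepared_def\<close>)
  then show ?thesis
  proof (rule run_mono)
    fix t s'
    assume *: "t \<le> 1000 * (n + 1)\<^sup>2 \<and>
      (\<forall>k\<in>{1..?l}. rarr s' ''L'' (int k) = rarr s ''W'' (int (T k)))"
    have "rarr s' ''L'' (int k) = lower_bd n X Y (family Q) (crit_l Q) (pt n X k)" if k: "k \<in> {1..?l}" for k
    proof -
      have "rarr s' ''L'' (int k) = rarr s ''W'' (int (T k))" using * k by blast
      also have "\<dots> = sentinels n Y (T k)" using s Tm[OF k] by (simp add: prepared_def)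
      also have "\<dots> = lower_bd n X Y (family Q) (crit_l Q) (pt n X k)" using T k by simp
      finally show ?thesis .
    qed
    then show "t \<le> 1000 * (n + 1)\<^sup>2 \<and> (\<forall>k\<in>{1..?l}. rarr s' ''L'' (int k) =
        lower_bd n X Y (family Q) (crit_l Q) (pt n X k))" using * by blast
  qed
qed

lemma run_sweep_down:
  assumes s: "prepared n X Y s"
    and fam: "interval_family n X (family Q)" and c: "\<And>N. N \<in> {1..n} \<Longrightarrow> crit_u Q N \<le> N"
  shows "run Q sweep_down s (\<lambda>t s'. t \<le> 1000 * (n + 1)\<^sup>2 \<and>
     (\<forall>k\<in>{1..card (X ` {1..n})}. rarr s' ''U'' (int k) = upper_bd n X Y (family Q) (crit_u Q) (pt n X k)))"
proof -
  let ?l = "card (X ` {1..n})" and ?m = "card (Y ` {1..n})"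
  let ?p = "\<lambda>i. ?l + 1 - rank_in n X (X i)" and ?r = "\<lambda>i. ?m + 1 - rank_in n Y (Y i)"
  obtain T where T: "\<forall>k\<in>{1..?l}. T k \<le> ?m \<and>
     upper_bd n X Y (family Q) (crit_u Q) (pt n X (?l + 1 - k)) = sentinels n Y (?m + 1 - T k) \<and>
     (\<forall>v\<le>?m. T k \<le> v \<longleftrightarrow> (\<forall>k'\<in>{1..k}. \<forall>j\<in>{1..k'}.
        {pt n X (?l + 1 - k')..pt n X (?l + 1 - j)} \<in> family Q \<longrightarrow>
        crit_u Q (card {i \<in> {1..n}. ?p i \<in> {j..k'}}) \<le> card {i \<in> {1..n}. ?p i \<in> {j..k'} \<and> ?r i \<le> v}))"
    using upper_threshold[OF fam, of "crit_u Q" Y] c by blast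
  have fr: "prepared n X Y \<sigma>" if "frame sweep_down s \<sigma>" for \<sigma>
    using s that by (simp add: prepared_def frame_def sweep_down_def)
  note fr' = fr[unfolded sweep_down_def]
  have Tm: "T k \<le> ?m" if "k \<in> {1..?l}" for k using T that by blast
  have mirror: "int b + 1 - int x = int (b + 1 - x)" if "x \<le> b + 1" for b x :: nat
    using that by simp
  have "run Q sweep_down s (\<lambda>t s'. t \<le> 1000 * (n + 1)\<^sup>2 \<and>
     (\<forall>k\<in>{1..?l}. rarr s' ''U'' (int (?l + 1 - k)) = rarr s ''W'' (int (?m + 1 - T k))))"
    unfolding sweep_down_def
  proof (rule run_sweep[where m = ?m and p = ?p and r = ?r and T = T and oi = "\<lambda>k. ?l + 1 - k" and wi = "\<lambda>v. ?m + 1 - v" and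
        F = "\<lambda>j k. {pt n X (?l + 1 - k)..pt n X (?l + 1 - j)} \<in> family Q" and c = "crit_u Q"], goal_cases)
    case (5 i)
    then show ?case using rank_in_bounds[of i n X] by auto
  next
    case (7 k v)
    then show ?case using T by blast
  next
    case 9
    then show ?case by (auto intro!: inj_onI)
  next
    case (10 \<sigma> i)
    then show ?case using fr'[OF 10(1)] rank_in_bounds[of i n X] by (simp add: prepared_def)
  next
    case (11 \<sigma> i)
    then show ?case using fr'[OF 11(1)] rank_in_bounds[of i n Y] by (simp add: prepared_def)
  next
    case (12 \<sigma> j k)
    have Z: "\<forall>k\<in>{1..?l}. rarr \<sigma> ''Z'' (int k) = ereal (pt n X k)" and len: "ivar \<sigma> ''len'' = int ?l"
      using fr'[OF 12(1)] by (simp_all add: prepared_def)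
    have "?l + 1 - j \<in> {1..?l}" "?l + 1 - k \<in> {1..?l}" "j \<le> ?l + 1" "k \<le> ?l + 1" using 12 by auto
    then have "rval Q (RArr ''Z'' (mirror ''len'' (IV ''j''))) \<sigma> = ereal (pt n X (?l + 1 - j))"
      "rval Q (RArr ''Z'' (mirror ''len'' (IV ''k''))) \<sigma> = ereal (pt n X (?l + 1 - k))"
      using Z by (simp_all only: rval.simps ival.simps len 12(4,5) of_nat_1 mirror)
    then show ?case by simp
  next
    case (14 \<sigma> k)
    then show ?case using fr'[OF 14(1)] by (simp add: prepared_def)
  next
    case (15 \<sigma> v)
    then show ?case using fr'[OF 15(1)] by (simp add: prepared_def)
  qed (use s Tm card_image_le_n in \<open>auto simp: prepared_def\<close>)
  then show ?thesis
  proof (rule run_mono)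
    fix t s'
    assume *: "t \<le> 1000 * (n + 1)\<^sup>2 \<and>
      (\<forall>k\<in>{1..?l}. rarr s' ''U'' (int (?l + 1 - k)) = rarr s ''W'' (int (?m + 1 - T k)))"
    have "rarr s' ''U'' (int k) = upper_bd n X Y (family Q) (crit_u Q) (pt n X k)" if k: "k \<in> {1..?l}" for k
    proof -
      let ?k = "?l + 1 - k"
      have k': "?k \<in> {1..?l}" "?l + 1 - ?k = k" using k by auto
      have "rarr s' ''U'' (int (?l + 1 - ?k)) = rarr s ''W'' (int (?m + 1 - T ?k))"
        using * k'(1) by blast
      also have "\<dots> = sentinels n Y (?m + 1 - T ?k)"
        using s by (simp add: prepared_def del: of_nat_diff)
      also have "\<dots> = upper_bd n X Y (family Q) (crit_u Q) (pt n X (?l + 1 - ?k))"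
        using T k'(1) by simp
      finally show ?thesis unfolding k'(2) .
    qed
    then show "t \<le> 1000 * (n + 1)\<^sup>2 \<and> (\<forall>k\<in>{1..?l}. rarr s' ''U'' (int k) =
        upper_bd n X Y (family Q) (crit_u Q) (pt n X k))" using * by blast
  qed
qed

text \<open>The algorithm.\<close>

definition bounds_com :: com where
  "bounds_com = Seq (compress ''X'' ''Z'' ''len'' ''P'') (Seq (compress ''Y'' ''W'' ''m'' ''R'')
     (Seq sweep_up sweep_down))"

lemma run_bounds_com:
  fixes Q :: queries
  assumes fam: "interval_family n X (family Q)"
    and cl: "\<And>N. N \<in> {1..n} \<Longrightarrow> crit_l Q N \<le> N" and cu: "\<And>N. N \<in> {1..n} \<Longrightarrow> crit_u Q N \<le> N"
  shows "run Q bounds_com (input_state n X Y) (\<lambda>t s. t \<le> 2400 * (n + 1)\<^sup>2 \<and>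
     output_is s (map (lower_bd n X Y (family Q) (crit_l Q)) (distinct_pts n X))
                 (map (upper_bd n X Y (family Q) (crit_u Q)) (distinct_pts n X)))"
proof -
  let ?s = "input_state n X Y" and ?l = "card (X ` {1..n})" and ?m = "card (Y ` {1..n})"
  have s: "ivar ?s ''n'' = int n" "\<And>i. i \<in> {1..n} \<Longrightarrow> rarr ?s ''X'' (int i) = ereal (X i)"
    "\<And>i. i \<in> {1..n} \<Longrightarrow> rarr ?s ''Y'' (int i) = ereal (Y i)"
    by (auto simp: input_state_def)
  show ?thesis
    unfolding bounds_com_def run_Seq
  proof (rule run_mono[OF run_compress[OF s(1,2)]], goal_cases)
    case (5 t1 s1)
    note s1 = 5
    have n1: "ivar s1 ''n'' = int n" and Y1: "\<And>i. i \<in> {1..n} \<Longrightarrow> rarr s1 ''Y'' (int i) = ereal (Y i)"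
      using s(1,3) s1(2) by (simp_all add: frame_def)
    show ?case
    proof (rule run_mono[OF run_compress[OF n1 Y1]], goal_cases)
      case (5 t2 s2)
      note s2 = 5
      have keep: "ivar s2 ''n'' = int n" "ivar s2 ''len'' = ivar s1 ''len''" "iarr s2 ''P'' = iarr s1 ''P''"
          "rarr s2 ''Z'' = rarr s1 ''Z''"
        using s2(2) n1 by (simp_all add: frame_def)
      have p2: "prepared n X Y s2"
        unfolding prepared_def keep using s1(1) s2(1) by (auto simp: sentinels_pt[symmetric])
      show ?case
      proof (rule run_mono[OF run_sweep_up[OF p2 fam cl]], goal_cases)
        case (2 t3 s3)
        note s3 = 2
        have p3: "prepared n X Y s3"
          using p2 2(2) by (simp add: prepared_def frame_def sweep_up_def)
        show ?case
        proof (rule run_mono[OF run_sweep_down[OF p3 fam cu]], goal_cases)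
          case (2 t4 s4)
          have p4: "ivar s4 ''len'' = int ?l" "rarr s4 ''L'' = rarr s3 ''L''"
            using p3 2(2) by (simp_all add: prepared_def frame_def sweep_down_def)
          have "t1 + (t2 + (t3 + t4)) \<le> 2400 * (n + 1)\<^sup>2"
            using s1(1) s2(1) s3(1) 2(1) by linarith
          moreover have "length (distinct_pts n X) = ?l" by (rule distinct_pts_props)
          ultimately show ?case
            using s3(1) 2(1) p4 by (auto simp: output_is_def pt_def)
        qed
      qed
    qed simp_all
  qed simp_all
qed

theorem mainTheorem2:
  shows "\<exists>(prog :: com) (C :: nat).
    \<forall>(n :: nat) (X :: nat \<Rightarrow> real) (Y :: nat \<Rightarrow> real) (\<B> :: real set set)
      (\<gamma> :: real) (\<kappa> :: real) (cl :: nat \<Rightarrow> nat) (cu :: nat \<Rightarrow> nat).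
      n \<ge> 1 \<and> interval_family n X \<B> \<and> 0 < \<gamma> \<and> \<gamma> < 1 \<and> 0 < \<kappa> \<and> \<kappa> \<le> 1 \<and>
      (\<forall>m \<in> {1..n}. cl m = binom_quantile m \<gamma> \<kappa> \<and> cu m = binom_quantile m (1 - \<gamma>) \<kappa>)
      \<longrightarrow> (\<exists>t s. exec \<lparr>crit_l = cl, crit_u = cu, family = \<B>\<rparr> prog (input_state n X Y) t s \<and>
             t \<le> C * n ^ 2 \<and>
             output_is s (map (lower_bd n X Y \<B> cl) (distinct_pts n X))
                         (map (upper_bd n X Y \<B> cu) (distinct_pts n X)))"
proof (rule exI[of _ bounds_com], rule exI[of _ 9600], intro allI impI, elim conjE)
  fix n :: nat and X Y :: "nat \<Rightarrow> real" and \<B> :: "real set set" and \<gamma> \<kappa> :: real and cl cu :: "nat \<Rightarrow> nat"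
  assume n: "n \<ge> 1" and fam: "interval_family n X \<B>" and \<gamma>: "0 < \<gamma>" "\<gamma> < 1" and \<kappa>: "\<kappa> \<le> 1"
    and c: "\<forall>m \<in> {1..n}. cl m = binom_quantile m \<gamma> \<kappa> \<and> cu m = binom_quantile m (1 - \<gamma>) \<kappa>"
  let ?Q = "\<lparr>crit_l = cl, crit_u = cu, family = \<B>\<rparr>"
  have "cl N \<le> N" "cu N \<le> N" if "N \<in> {1..n}" for N
    using c that \<gamma> \<kappa> by (simp_all add: binom_quantile_le)
  then have "run ?Q bounds_com (input_state n X Y) (\<lambda>t s. t \<le> 2400 * (n + 1)\<^sup>2 \<and>
     output_is s (map (lower_bd n X Y \<B> cl) (distinct_pts n X)) (map (upper_bd n X Y \<B> cu) (distinct_pts n X)))"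
    using run_bounds_com[of n X ?Q Y] fam by simp
  \<comment> \<open>Since \<open>n + 1 \<le> 2 n\<close>.\<close>
  moreover have "2400 * (n + 1)\<^sup>2 \<le> 9600 * n\<^sup>2"
    using power_mono[of "n + 1" "2 * n" 2] n by (simp add: power_mult_distrib)
  ultimately show "\<exists>t s. exec ?Q bounds_com (input_state n X Y) t s \<and> t \<le> 9600 * n\<^sup>2 \<and>
     output_is s (map (lower_bd n X Y \<B> cl) (distinct_pts n X)) (map (upper_bd n X Y \<B> cu) (distinct_pts n X))"
    unfolding run_def by (meson le_trans)
qed

end
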